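(* Let $N\ge 2$, let $X\subset\{1,\dots,N\}$ with $|X|=\kappa\in\{1,\dots,N-1\}$, and let $X^c$ be its complement. For each $l\in\{1,\dots,N\}$ let $H_l=\sum_{i=0}^{1}(E_l+i\alpha_l)|i\rangle\langle i|$ with $E_l\in\mathbb{R}$ and $\alpha_l\ge 0$, and let the $N$-qubit Hamiltonian be the non-interacting Hamiltonian $H=\sum_{l=1}^N\tilde H_l$. Let $0=n_0\le n_1\le\dots\le n_{2^N-1}$ be the eigenvalues (with multiplicity) of $H-E_g$, and $0=m_0\le m_1\le\dots\le m_{2^\kappa-1}=\sum_{l\in X}\alpha_l$ the eigenvalues (with multiplicity) of $H_X-E_g^X$. Let $\rho$ be an $N$-qubit state that is separable across the $X$-vs-$X^c$ bipartition, let $t_0\ge t_1\ge\dots\ge t_{2^N-1}$ be the eigenvalues of $\rho$ and $x_0\ge x_1\ge\dots\ge x_{2^\kappa-1}$ the eigenvalues of $\rho_X$. Then $$\Delta_{X|X^c}\le \sum_{i=1}^{2^\kappa-1}(m_i-m_1)x_i+\sum_{i=1}^{2^N-1}(m_1-n_i)t_i$$ and $$\Delta_{X|X^c}\le\sum_{i=1}^{2^\kappa-2}(m_i-n_i)t_i+\sum_{i=2^\kappa-1}^{2^N-1}(m_{2^\kappa-1}-n_i)t_i,$$ where $\Delta_{X|X^c}=W(\rho)-W_{[\kappa]}(\rho_X)-E(\rho_{X^c})+E_g^{X^c}$.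
   Context: An $N$-qubit state is a positive semidefinite trace-one operator on $(\mathbb{C}^2)^{\otimes N}$. For $X\subset\{1,\dots,N\}$, $\rho_X=\mathrm{Tr}_{X^c}(\rho)$ denotes the reduced state on the qubits in $X$. The state $\rho$ is separable across $X$-vs-$X^c$ if it is a convex combination of product states $\sigma_X\otimes\tau_{X^c}$. $\tilde H_l$ denotes $H_l$ acting on the $l$-th qubit tensored with identities on all the others; $|0\rangle,|1\rangle$ is the computational (energy) basis of each qubit. For a subset $Y$ of the qubits, $H_Y$ is the sum of the local Hamiltonians of the qubits in $Y$, acting on the Hilbert space of $Y$; its ground-state energy is $E_g^Y=\sum_{l\in Y}E_l$. For the whole system $E_g=\sum_{l=1}^N E_l$. The energy of a state $\sigma$ of $Y$ is $E(\sigma)=\mathrm{Tr}[\sigma H_Y]$. The ergotropy of a state $\sigma$ with respect to its Hamiltonian $H_Y$ is $\mathrm{Tr}[\sigma H_Y]-\min_U\mathrm{Tr}[U\sigma U^\dagger H_Y]$, the minimum being over all unitaries $U$ on the Hilbert space of $Y$; equivalently it equals $E(\sigma)-E(\sigma^P)$, where the passive state $\sigma^P$ has the same spectrum as $\sigma$, is diagonal in an eigenbasis of $H_Y$, and has its eigenvalues in decreasing order assigned to energy eigenvectors in increasing order of energy. $W(\rho)$ denotes the ergotropy of $\rho$ with respect to $H$, and $W_{[\kappa]}(\rho_X)$ the ergotropy of $\rho_X$ with respect to $H_X$. *)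

theory Defs
  imports "Jordan_Normal_Form.Char_Poly" "Jordan_Normal_Form.Schur_Decomposition"
begin

text \<open>
  Qubits are labelled by natural numbers. The Hilbert space of a finite set Y of qubits has
  dimension \<open>2 ^ card Y\<close>; an index \<open>k < 2 ^ card Y\<close> stands for the computational basis vector in
  which qubit \<open>l \<in> Y\<close> is in state \<open>|1\<rangle>\<close> iff bit number \<open>qubit_pos Y l\<close> of k is set.
\<close>

definition qubit_pos :: "nat set \<Rightarrow> nat \<Rightarrow> nat" where
  "qubit_pos Y l = card {j \<in> Y. j < l}"

text \<open>For \<open>Z \<subseteq> Y\<close>, the index over Z of the part on Z of the basis vector of Y with index k.\<close>

definition restrict_index :: "nat set \<Rightarrow> nat set \<Rightarrow> nat \<Rightarrow> nat" where
  "restrict_index Y Z k =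
     (\<Sum>l\<in>Z. if bit k (qubit_pos Y l) then 2 ^ qubit_pos Z l else 0)"

text \<open>
  The operator on Y acting as A on the qubits in \<open>Z \<subseteq> Y\<close> and as B on those in \<open>Y - Z\<close>. The
  indexing takes care of the tensor factors of Z not being adjacent.
\<close>

definition tensor_op :: "nat set \<Rightarrow> nat set \<Rightarrow> complex mat \<Rightarrow> complex mat \<Rightarrow> complex mat" where
  "tensor_op Y Z A B = mat (2 ^ card Y) (2 ^ card Y) (\<lambda>(i, j).
     A $$ (restrict_index Y Z i, restrict_index Y Z j) *
     B $$ (restrict_index Y (Y - Z) i, restrict_index Y (Y - Z) j))"

text \<open>The reduced operator on \<open>Z \<subseteq> Y\<close>: the qubits in \<open>Y - Z\<close> are traced out.\<close>

definition reduced_op :: "nat set \<Rightarrow> nat set \<Rightarrow> complex mat \<Rightarrow> complex mat" where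
  "reduced_op Y Z A = mat (2 ^ card Z) (2 ^ card Z) (\<lambda>(i, j).
     \<Sum>(k, k') | k < 2 ^ card Y \<and> k' < 2 ^ card Y \<and>
                restrict_index Y Z k = i \<and> restrict_index Y Z k' = j \<and>
                restrict_index Y (Y - Z) k = restrict_index Y (Y - Z) k'.
       A $$ (k, k'))"

definition mat_trace :: "complex mat \<Rightarrow> complex" where
  "mat_trace A = (\<Sum>i<dim_row A. A $$ (i, i))"

definition positive_semidefinite :: "complex mat \<Rightarrow> bool" where
  "positive_semidefinite A \<longleftrightarrow> square_mat A \<and> mat_adjoint A = A \<and>
     (\<forall>v \<in> carrier_vec (dim_row A). 0 \<le> Re ((A *\<^sub>v v) \<bullet>c v))"

definition qubit_state :: "nat set \<Rightarrow> complex mat \<Rightarrow> bool" where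
  "qubit_state Y \<rho> \<longleftrightarrow> \<rho> \<in> carrier_mat (2 ^ card Y) (2 ^ card Y) \<and>
     positive_semidefinite \<rho> \<and> mat_trace \<rho> = 1"

definition separable_across :: "nat set \<Rightarrow> nat set \<Rightarrow> complex mat \<Rightarrow> bool" where
  "separable_across Y X \<rho> \<longleftrightarrow> (\<exists>(K :: nat) p \<sigma> \<tau>.
     (\<forall>k<K. 0 \<le> p k \<and> qubit_state X (\<sigma> k) \<and> qubit_state (Y - X) (\<tau> k)) \<and>
     (\<Sum>k<K. p k) = (1 :: real) \<and>
     \<rho> = mat (2 ^ card Y) (2 ^ card Y) (\<lambda>ij.
           \<Sum>k<K. complex_of_real (p k) * tensor_op Y X (\<sigma> k) (\<tau> k) $$ ij))"

definition local_hamiltonian :: "(nat \<Rightarrow> real) \<Rightarrow> (nat \<Rightarrow> real) \<Rightarrow> nat \<Rightarrow> complex mat" where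
  "local_hamiltonian E \<alpha> l = mat_diag 2 (\<lambda>i. complex_of_real (E l + real i * \<alpha> l))"

definition hamiltonian :: "(nat \<Rightarrow> real) \<Rightarrow> (nat \<Rightarrow> real) \<Rightarrow> nat set \<Rightarrow> complex mat" where
  "hamiltonian E \<alpha> Y = mat (2 ^ card Y) (2 ^ card Y) (\<lambda>ij.
     \<Sum>l\<in>Y. tensor_op Y {l} (local_hamiltonian E \<alpha> l) (1\<^sub>m (2 ^ card (Y - {l}))) $$ ij)"

definition ground_energy :: "(nat \<Rightarrow> real) \<Rightarrow> nat set \<Rightarrow> real" where
  "ground_energy E Y = (\<Sum>l\<in>Y. E l)"

text \<open>\<open>Re\<close> only changes the type: the trace is real for Hermitian arguments.\<close>

definition energy :: "complex mat \<Rightarrow> complex mat \<Rightarrow> real" where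
  "energy H \<sigma> = Re (mat_trace (\<sigma> * H))"

definition unitary_mats :: "nat \<Rightarrow> complex mat set" where
  "unitary_mats d = {U \<in> carrier_mat d d. U * mat_adjoint U = 1\<^sub>m d \<and> mat_adjoint U * U = 1\<^sub>m d}"

text \<open>The infimum is a minimum, the unitary group being compact.\<close>

definition ergotropy :: "complex mat \<Rightarrow> complex mat \<Rightarrow> real" where
  "ergotropy H \<sigma> =
     energy H \<sigma> - (INF U \<in> unitary_mats (dim_row H). energy H (U * \<sigma> * mat_adjoint U))"

text \<open>\<open>e 0, e 1, \<dots>\<close> are the eigenvalues of A, counted with algebraic multiplicity.\<close>

definition eigenvalues_of :: "complex mat \<Rightarrow> (nat \<Rightarrow> real) \<Rightarrow> bool" where
  "eigenvalues_of A e \<longleftrightarrow> char_poly A = (\<Prod>i<dim_row A. [:- complex_of_real (e i), 1:])"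

definition ergotropic_gap ::
    "(nat \<Rightarrow> real) \<Rightarrow> (nat \<Rightarrow> real) \<Rightarrow> nat set \<Rightarrow> nat set \<Rightarrow> complex mat \<Rightarrow> real" where
  "ergotropic_gap E \<alpha> Y X \<rho> =
     ergotropy (hamiltonian E \<alpha> Y) \<rho>
     - ergotropy (hamiltonian E \<alpha> X) (reduced_op Y X \<rho>)
     - energy (hamiltonian E \<alpha> (Y - X)) (reduced_op Y (Y - X) \<rho>)
     + ground_energy E (Y - X)"

end

theory Submission
  imports Defs
begin

text \<open>
  Since the passive energy of a state is the pairing of its decreasing spectrum with the increasing
  spectrum of the Hamiltonian, and since the energy of \<open>\<rho>\<close> splits into those of the two marginals,
  the gap equals \<open>\<Sum>i. m i * x i - \<Sum>i. n i * t i\<close>. Both bounds then follow from the Nielsen--Kempe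
  theorem: for separable \<open>\<rho>\<close> the spectrum t is majorized by x. The first bound only uses
  \<open>t 0 \<le> x 0\<close>; the second one pairs t and x, padded by zeros, with the increasing
  sequence m, continued by its last value, and sums by parts.

  For majorization, write \<open>\<rho>\<close> as a sum of projections onto product vectors \<open>a w \<otimes> b w\<close> with unit
  vectors \<open>b w\<close>. Expanding the eigenvectors of \<open>\<rho>\<close> in these, and the \<open>a w\<close> in eigenvectors of the
  marginal, expresses t as the image of x under a matrix of nonnegative entries. Bessel's inequality,
  applied once for each of the two orthonormal systems of coefficients, shows that it is doubly
  substochastic.
\<close>

section \<open>Unitary matrices and the spectral theorem\<close>

lemma mat_adjoint_eq: "mat_adjoint A = mat (dim_col A) (dim_row A) (\<lambda>(i, j). cnj (A $$ (j, i)))"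
  by (rule eq_matI) (auto simp: mat_adjoint_def mat_of_rows_def conjugate_complex_def)

lemma mat_adjoint_carrier [simp]:
  "A \<in> carrier_mat n m \<Longrightarrow> mat_adjoint (A :: complex mat) \<in> carrier_mat m n"
  by (auto simp: mat_adjoint_eq)

lemma dim_mat_adjoint [simp]:
  "dim_row (mat_adjoint (A :: complex mat)) = dim_col A"
  "dim_col (mat_adjoint (A :: complex mat)) = dim_row A"
  by (auto simp: mat_adjoint_eq)

lemma index_mat_adjoint [simp]:
  "i < dim_col A \<Longrightarrow> j < dim_row A \<Longrightarrow> mat_adjoint A $$ (i, j) = cnj (A $$ (j, i))"
  by (simp add: mat_adjoint_eq)

lemma mat_adjoint_adjoint [simp]: "mat_adjoint (mat_adjoint (A :: complex mat)) = A"
  by (rule eq_matI) auto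

lemma mat_adjoint_mult:
  fixes A B :: "complex mat"
  assumes "A \<in> carrier_mat n m" "B \<in> carrier_mat m k"
  shows "mat_adjoint (A * B) = mat_adjoint B * mat_adjoint A"
  using assms by (intro eq_matI) (auto simp: scalar_prod_def mult.commute intro!: sum.cong)

lemma index_mult_mat_sum:
  assumes "A \<in> carrier_mat n m" "B \<in> carrier_mat m k" "i < n" "j < k"
  shows "(A * B) $$ (i, j) = (\<Sum>l<m. A $$ (i, l) * B $$ (l, j))"
  using assms by (auto simp: scalar_prod_def lessThan_atLeast0)

lemma unitary_matsD:
  assumes "U \<in> unitary_mats n"
  shows "U \<in> carrier_mat n n" "mat_adjoint U \<in> carrier_mat n n"
    "U * mat_adjoint U = 1\<^sub>m n" "mat_adjoint U * U = 1\<^sub>m n"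
  using assms by (auto simp: unitary_mats_def)

lemma unitary_matsI:
  assumes "U \<in> carrier_mat n n" "mat_adjoint U * U = 1\<^sub>m n"
  shows "U \<in> unitary_mats n"
  using assms mat_mult_left_right_inverse[of "mat_adjoint U" n U] by (auto simp: unitary_mats_def)

lemma unitary_mats_adjoint: "U \<in> unitary_mats n \<Longrightarrow> mat_adjoint U \<in> unitary_mats n"
  by (auto simp: unitary_mats_def)

lemma unitary_cancel:
  assumes U: "U \<in> unitary_mats n" and B: "B \<in> carrier_mat n m"
  shows "mat_adjoint U * (U * B) = B" "U * (mat_adjoint U * B) = B"
  using unitary_matsD[OF U] B
  by (simp_all add: assoc_mult_mat[of _ n n _ n _ m, symmetric])

lemma unitary_mats_mult:
  assumes U: "U \<in> unitary_mats n" and V: "V \<in> unitary_mats n"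
  shows "U * V \<in> unitary_mats n"
proof (rule unitary_matsI)
  note u = unitary_matsD[OF U] and v = unitary_matsD[OF V]
  show "U * V \<in> carrier_mat n n" using u v by auto
  show "mat_adjoint (U * V) * (U * V) = 1\<^sub>m n"
    using u v unitary_cancel[OF U, of V n]
    by (simp add: mat_adjoint_mult[of U n n V n] assoc_mult_mat[of _ n n _ n _ n])
qed

lemma unitary_cols_orthonormal:
  assumes U: "U \<in> unitary_mats n" and "i < n" "j < n"
  shows "(\<Sum>k<n. cnj (U $$ (k, i)) * U $$ (k, j)) = (if i = j then 1 else 0)"
proof -
  note u = unitary_matsD[OF U]
  have "(mat_adjoint U * U) $$ (i, j) = (\<Sum>k<n. cnj (U $$ (k, i)) * U $$ (k, j))"
    using u assms by (subst index_mult_mat_sum[of _ n n _ n]) (auto intro!: sum.cong)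
  then show ?thesis using u assms by simp
qed

lemma unitary_rows_orthonormal:
  assumes U: "U \<in> unitary_mats n" and "i < n" "j < n"
  shows "(\<Sum>k<n. U $$ (i, k) * cnj (U $$ (j, k))) = (if i = j then 1 else 0)"
  using unitary_cols_orthonormal[OF unitary_mats_adjoint[OF U] assms(2,3)] unitary_matsD(1)[OF U] assms(2,3)
  by simp

text \<open>Complete \<open>v\<close> to a basis and orthogonalize: Gram-Schmidt keeps the first
  vector, so normalization makes the first column a multiple of \<open>v\<close>. This splits off
  one eigenvector in the spectral theorem below.\<close>

lemma unitary_with_first_column:
  assumes v: "v \<in> carrier_vec n" and v0: "v \<noteq> 0\<^sub>v n"
  obtains U c where "U \<in> unitary_mats n" "col U 0 = c \<cdot>\<^sub>v v" "c \<noteq> (0 :: complex)"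
proof -
  define b where "b = basis_completion v"
  define ws where "ws = gram_schmidt n b"
  interpret cof_vec_space n "TYPE(complex)" .
  have n: "n \<noteq> 0"
    using v v0 by (metis carrier_vecD eq_vecI index_zero_vec(2) less_nat_zero_code)
  from basis_completion[OF v v0, folded b_def]
  have dist_b: "distinct b" and indep: "\<not> lin_dep (set b)" and b: "set b \<subseteq> carrier_vec n"
    and hdb: "hd b = v" and len_b: "length b = n" by auto
  from hdb len_b n obtain vs where bv: "b = v # vs" by (cases b) auto
  from gram_schmidt_result[OF b dist_b indep refl, folded ws_def]
  have ws: "set ws \<subseteq> carrier_vec n" "corthogonal ws" "length ws = n" by (auto simp: len_b)
  have hdws: "ws ! 0 = v"
    using gram_schmidt_hd[OF v, of vs, folded bv] ws(3) n unfolding ws_def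
    by (metis hd_conv_nth list.size(3))
  have wsc: "ws ! i \<in> carrier_vec n" if "i < n" for i using ws that by auto
  \<comment> \<open>Gram-Schmidt yields orthogonal vectors of nonzero but arbitrary length;
    \<open>r i\<close> is the squared length, by whose root column \<open>i\<close> is
    divided.\<close>
  define r where "r i = Re (ws ! i \<bullet>c ws ! i)" for i
  have rr: "ws ! i \<bullet>c ws ! i = complex_of_real (r i)" "r i > 0" if "i < n" for i
  proof -
    have e: "ws ! i \<bullet>c ws ! i = complex_of_real (\<Sum>k<n. (cmod (ws ! i $ k))\<^sup>2)"
      using wsc[OF that] unfolding scalar_prod_def
      by (auto simp: complex_norm_square conjugate_complex_def lessThan_atLeast0 simp flip: of_real_power intro!: sum.cong)
    moreover have "ws ! i \<bullet>c ws ! i \<noteq> 0" using corthogonalD[OF ws(2), of i i] ws(3) that by simp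
    then have "(\<Sum>k<n. (cmod (ws ! i $ k))\<^sup>2) \<noteq> 0" unfolding e by (metis of_real_0)
    moreover have "(\<Sum>k<n. (cmod (ws ! i $ k))\<^sup>2) \<ge> 0" by (simp add: sum_nonneg)
    ultimately show "ws ! i \<bullet>c ws ! i = complex_of_real (r i)" "r i > 0"
      unfolding r_def by (simp_all add: less_le del: of_real_sum)
  qed
  define U where "U = mat n n (\<lambda>(i, j). complex_of_real (1 / sqrt (r j)) * ws ! j $ i)"
  have U: "U \<in> carrier_mat n n" by (simp add: U_def)
  have "U \<in> unitary_mats n"
  proof (rule unitary_matsI[OF U], rule eq_matI)
    fix i j assume "i < dim_row (1\<^sub>m n :: complex mat)" "j < dim_col (1\<^sub>m n :: complex mat)"
    then have ij: "i < n" "j < n" by auto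
    have "(mat_adjoint U * U) $$ (i, j) = (\<Sum>k<n. cnj (U $$ (k, i)) * U $$ (k, j))"
      using U ij by (subst index_mult_mat_sum[of _ n n _ n]) (auto intro!: sum.cong)
    also have "\<dots> = complex_of_real (1 / sqrt (r i) * (1 / sqrt (r j))) * (\<Sum>k<n. ws ! j $ k * cnj (ws ! i $ k))"
      unfolding sum_distrib_left using ij by (intro sum.cong) (auto simp: U_def)
    also have "(\<Sum>k<n. ws ! j $ k * cnj (ws ! i $ k)) = ws ! j \<bullet>c ws ! i"
      using wsc[of i] wsc[of j] ij unfolding scalar_prod_def
      by (auto simp: conjugate_complex_def lessThan_atLeast0 intro!: sum.cong)
    also have "\<dots> = (if i = j then complex_of_real (r i) else 0)"
      using corthogonalD[OF ws(2), of j i] ws(3) ij rr by auto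
    also have "complex_of_real (1 / sqrt (r i) * (1 / sqrt (r j))) * \<dots> = (if i = j then 1 else 0)"
      using rr(2)[OF ij(1)] by (auto simp flip: of_real_mult simp: field_simps)
    finally show "(mat_adjoint U * U) $$ (i, j) = 1\<^sub>m n $$ (i, j)" using ij by simp
  qed (use U in auto)
  moreover have "col U 0 = complex_of_real (1 / sqrt (r 0)) \<cdot>\<^sub>v v"
    using n v hdws by (intro eq_vecI) (auto simp: U_def)
  moreover have "complex_of_real (1 / sqrt (r 0)) \<noteq> 0" using rr(2)[of 0] n by simp
  ultimately show ?thesis using that by blast
qed

lemma mat_adjoint_mat_diag: "mat_adjoint (mat_diag n f) = mat_diag n (\<lambda>i. cnj (f i))"
  by (rule eq_matI) (auto simp: mat_diag_def)

lemma similar_unitary_conj: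
  assumes "U \<in> unitary_mats n" "A \<in> carrier_mat n n"
  shows "similar_mat (mat_adjoint U * A * U) A"
  unfolding similar_mat_def similar_mat_wit_def Let_def
  using unitary_matsD[OF assms(1)] assms(2)
  by (intro exI[of _ "mat_adjoint U"] exI[of _ U]) auto

lemma unitary_conj_cancel:
  assumes U: "U \<in> unitary_mats n" and A: "A \<in> carrier_mat n n"
  shows "U * (mat_adjoint U * A * U) * mat_adjoint U = A"
proof -
  note u = unitary_matsD[OF U]
  have AU: "A * U \<in> carrier_mat n n" using A u by simp
  have "mat_adjoint U * A * U = mat_adjoint U * (A * U)"
    using A u by (simp add: assoc_mult_mat[of _ n n _ n _ n])
  then have "U * (mat_adjoint U * A * U) * mat_adjoint U = A * U * mat_adjoint U"
    by (simp only: unitary_cancel(2)[OF U AU])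
  also have "\<dots> = A" using A u by (simp add: assoc_mult_mat[of _ n n _ n _ n])
  finally show ?thesis .
qed

text \<open>Induction on the eigenvalue list: a unitary whose first column is an eigenvector for
  \<open>e\<close> brings \<open>A\<close> to block form, and the remaining block is Hermitian with
  the remaining list as spectrum. The diagonal follows the order of the list, so that a sorted one
  can be prescribed later.\<close>

lemma hermitian_unitary_diagonal_list:
  assumes "A \<in> carrier_mat n n" "mat_adjoint A = A" "char_poly A = (\<Prod>e\<leftarrow>es. [:- e, 1:])"
  shows "\<exists>U \<in> unitary_mats n. A = U * mat_diag n (\<lambda>i. es ! i) * mat_adjoint U"
  using assms
proof (induction es arbitrary: n A)
  case Nil
  have "n = 0" using degree_monic_char_poly[OF Nil.prems(1)] Nil.prems(3) by simp
  then show ?case using Nil.prems(1)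
    by (intro bexI[of _ "1\<^sub>m 0"] eq_matI unitary_matsI) auto
next
  case (Cons e es)
  note A = Cons.prems(1)
  have mon: "monic (\<Prod>e\<leftarrow>es. [:- e, 1:])" by (rule monic_prod_list) auto
  have "degree (char_poly A) = Suc (degree (\<Prod>e\<leftarrow>es. [:- e, 1:]))"
    unfolding Cons.prems(3) list.map prod_list.Cons by (subst degree_mult_eq, insert mon, auto)
  then obtain n1 where n: "n = Suc n1" using degree_monic_char_poly[OF A] by (cases n) auto
  have "eigenvalue A e" unfolding eigenvalue_root_char_poly[OF A] Cons.prems(3) by simp
  then obtain v where v: "v \<in> carrier_vec n" "v \<noteq> 0\<^sub>v n" and Av: "A *\<^sub>v v = e \<cdot>\<^sub>v v"
    using A unfolding eigenvalue_def eigenvector_def by auto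
  obtain U c where U: "U \<in> unitary_mats n" and Uv: "col U 0 = c \<cdot>\<^sub>v v"
    using unitary_with_first_column[OF v] by metis
  note u = unitary_matsD[OF U]
  define A' where "A' = mat_adjoint U * A * U"
  have A': "A' \<in> carrier_mat n n" using u A by (auto simp: A'_def)
  have A'h: "mat_adjoint A' = A'"
    unfolding A'_def using u A Cons.prems(2)
    by (simp add: mat_adjoint_mult[of _ n n _ n] assoc_mult_mat[of _ n n _ n _ n])
  have "col (A * U) 0 = e \<cdot>\<^sub>v col U 0"
  proof -
    have "col (A * U) 0 = A *\<^sub>v col U 0" using A u n by (intro col_mult2) auto
    then show ?thesis using Uv A v Av by (simp add: mult_mat_vec[of A n n] smult_smult_assoc mult.commute)
  qed
  then have c0: "(A * U) $$ (i, 0) = e * U $$ (i, 0)" if "i < n" for i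
  proof -
    have "(A * U) $$ (i, 0) = col (A * U) 0 $ i"
      using that A u n by (intro index_col[symmetric]) auto
    also have "\<dots> = (e \<cdot>\<^sub>v col U 0) $ i" by (simp only: \<open>col (A * U) 0 = e \<cdot>\<^sub>v col U 0\<close>)
    finally show ?thesis using that u n by simp
  qed
  have A'0: "A' $$ (i, 0) = (if i = 0 then e else 0)" if i: "i < n" for i
  proof -
    have "A' = mat_adjoint U * (A * U)" unfolding A'_def using u A by (simp add: assoc_mult_mat[of _ n n _ n _ n])
    then have "A' $$ (i, 0) = (\<Sum>k<n. mat_adjoint U $$ (i, k) * (A * U) $$ (k, 0))"
      using u A i n by (simp add: index_mult_mat_sum[of _ n n _ n] del: index_mult_mat(1))
    also have "\<dots> = e * (\<Sum>k<n. cnj (U $$ (k, i)) * U $$ (k, 0))"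
      unfolding sum_distrib_left using u i c0 by (intro sum.cong) auto
    also have "\<dots> = (if i = 0 then e else 0)"
      using unitary_cols_orthonormal[OF U i, of 0] n by simp
    finally show ?thesis .
  qed
  \<comment> \<open>Hermiticity carries the zeros of the first column over to the first row.\<close>
  have A'r: "A' $$ (0, i) = (if i = 0 then e else 0)" if i: "i < n" for i
  proof (cases "i = 0")
    case False
    have "A' $$ (0, i) = mat_adjoint A' $$ (0, i)" using A'h by simp
    also have "\<dots> = cnj (A' $$ (i, 0))" using A' i n by (intro index_mat_adjoint) auto
    finally show ?thesis using A'0[OF i] False by simp
  qed (use A'0 i in simp)
  define A3 where "A3 = mat n1 n1 (\<lambda>(i, j). A' $$ (Suc i, Suc j))"
  have A3: "A3 \<in> carrier_mat n1 n1" by (simp add: A3_def)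
  have blk: "A' = four_block_mat (mat 1 1 (\<lambda>_. e)) (0\<^sub>m 1 n1) (0\<^sub>m n1 1) A3"
    using A' n A'0 A'r by (intro eq_matI) (auto simp: A3_def)
  have A3h: "mat_adjoint A3 = A3"
  proof (rule eq_matI)
    fix i j assume "i < dim_row A3" "j < dim_col A3"
    then have ij: "i < n1" "j < n1" using A3 by auto
    have "mat_adjoint A' $$ (Suc i, Suc j) = cnj (A' $$ (Suc j, Suc i))"
      using A' n ij by (intro index_mat_adjoint) auto
    then show "mat_adjoint A3 $$ (i, j) = A3 $$ (i, j)" using A'h ij by (simp add: A3_def)
  qed (use A3 in auto)
  \<comment> \<open>Similarity and the block form give two factorizations of the characteristic
    polynomial; cancelling the factor of \<open>e\<close> leaves the list \<open>es\<close> for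
    \<open>A3\<close>.\<close>
  have "char_poly A' = [:- e, 1:] * (\<Prod>e\<leftarrow>es. [:- e, 1:])"
    using char_poly_similar[OF similar_unitary_conj[OF U A]] Cons.prems(3) by (simp add: A'_def)
  moreover have "char_poly A' = char_poly (mat 1 1 (\<lambda>_. e)) * char_poly A3"
    unfolding blk by (rule char_poly_four_block_zeros_col[OF _ _ A3]) auto
  moreover have "char_poly (mat 1 1 (\<lambda>_. e)) = [: -e,1 :]"
    by (simp add: char_poly_defs det_def sign_def)
  ultimately have "char_poly A3 = (\<Prod>e\<leftarrow>es. [:- e, 1:])"
    by (metis mult_cancel_left pCons_eq_0_iff zero_neq_one)
  from Cons.IH[OF A3 A3h this] obtain V where V: "V \<in> unitary_mats n1"
    and A3V: "A3 = V * mat_diag n1 (\<lambda>i. es ! i) * mat_adjoint V" by auto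
  note w = unitary_matsD[OF V]
  \<comment> \<open>The unitary diagonalizing the block, with a 1 added in the corner; combined with
    \<open>U\<close> it diagonalizes \<open>A\<close>.\<close>
  define V' where "V' = four_block_mat (1\<^sub>m 1) (0\<^sub>m 1 n1) (0\<^sub>m n1 1) V"
  have V'a: "mat_adjoint V' = four_block_mat (1\<^sub>m 1) (0\<^sub>m 1 n1) (0\<^sub>m n1 1) (mat_adjoint V)"
    using w by (intro eq_matI) (auto simp: V'_def)
  have V'c: "V' \<in> carrier_mat n n" using w n by (auto simp: V'_def)
  have "mat_adjoint V' * V' = four_block_mat (1\<^sub>m 1) (0\<^sub>m 1 n1) (0\<^sub>m n1 1) (1\<^sub>m n1)"
    unfolding V'a unfolding V'_def using w
    by (subst mult_four_block_mat[of _ 1 1 _ n1 _ n1 _ _ 1 _ n1]) auto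
  also have "\<dots> = 1\<^sub>m n" using n by (metis four_block_one_mat plus_1_eq_Suc)
  finally have V': "V' \<in> unitary_mats n" using V'c by (intro unitary_matsI)
  have D: "mat_diag n (\<lambda>i. (e # es) ! i) =
      four_block_mat (mat 1 1 (\<lambda>_. e)) (0\<^sub>m 1 n1) (0\<^sub>m n1 1) (mat_diag n1 (\<lambda>i. es ! i))"
    using n by (intro eq_matI) (auto simp: mat_diag_def)
  have "V' * mat_diag n (\<lambda>i. (e # es) ! i) * mat_adjoint V' = A'"
  proof -
    have "V' * mat_diag n (\<lambda>i. (e # es) ! i) =
        four_block_mat (mat 1 1 (\<lambda>_. e)) (0\<^sub>m 1 n1) (0\<^sub>m n1 1) (V * mat_diag n1 (\<lambda>i. es ! i))"
      unfolding D V'_def using w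
      by (subst mult_four_block_mat[of _ 1 1 _ n1 _ n1 _ _ 1 _ n1])
        (auto simp: left_mult_zero_mat[OF mat_diag_dim])
    moreover have VD: "V * mat_diag n1 (\<lambda>i. es ! i) \<in> carrier_mat n1 n1"
      using w mat_diag_dim[of n1 "\<lambda>i. es ! i"] by (intro mult_carrier_mat)
    moreover have "V * mat_diag n1 (\<lambda>i. es ! i) * mat_adjoint V \<in> carrier_mat n1 n1"
      using w by (intro mult_carrier_mat[OF VD])
    ultimately show ?thesis unfolding blk V'a A3V using w
      by (simp, subst mult_four_block_mat[of _ 1 1 _ n1 _ n1 _ _ 1 _ n1])
        (auto simp: right_mult_zero_mat[OF VD])
  qed
  then have "A = U * (V' * mat_diag n (\<lambda>i. (e # es) ! i) * mat_adjoint V') * mat_adjoint U"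
    using unitary_conj_cancel[OF U A] by (simp add: A'_def)
  also have "\<dots> = (U * V') * mat_diag n (\<lambda>i. (e # es) ! i) * mat_adjoint (U * V')"
    using u V'c mat_adjoint_carrier[OF V'c] mat_diag_dim[of n "\<lambda>i. (e # es) ! i"]
    by (simp add: mat_adjoint_mult[of _ n n _ n] assoc_mult_mat[of _ n n _ n _ n]
        mult_carrier_mat[of _ n n _ n])
  finally show ?case using unitary_mats_mult[OF U V'] by blast
qed

section \<open>Sums with monotone weights\<close>

text \<open>Summation by parts: the difference of the two sides is made of increments of
  \<open>f\<close> times partial sums of \<open>a - b\<close>, both nonnegative, while the boundary
  term vanishes by equality of the totals.\<close>

lemma sum_mono_weights_le:
  fixes f a b :: "nat \<Rightarrow> real"
  assumes f: "mono_on {..<n} f"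
    and le: "\<And>k. k < n \<Longrightarrow> sum b {..<k} \<le> sum a {..<k}"
    and eq: "sum a {..<n} = sum b {..<n}"
  shows "(\<Sum>i<n. f i * a i) \<le> (\<Sum>i<n. f i * b i)"
proof (cases n)
  case (Suc n')
  define C where "C k = sum b {..<k} - sum a {..<k}" for k
  \<comment> \<open>Keeping the boundary term on the left makes the claim inductive; at the last
    index it is 0 because \<open>C n = 0\<close>.\<close>
  have "f k * C (Suc k) \<le> (\<Sum>i<Suc k. f i * (b i - a i))" if "k < n" for k
    using that
  proof (induction k)
    case (Suc k)
    have "(f (Suc k) - f k) * C (Suc k) \<le> 0"
      using le[OF Suc.prems] Suc.prems
      by (intro mult_nonneg_nonpos) (auto simp: C_def intro: monotone_onD[OF f])
    then have "f (Suc k) * C (Suc k) \<le> (\<Sum>i<Suc k. f i * (b i - a i))"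
      using Suc.IH Suc.prems by (simp add: left_diff_distrib del: sum.lessThan_Suc)
    then show ?case by (simp add: C_def algebra_simps)
  qed (simp add: C_def)
  from this[of n'] Suc eq show ?thesis
    by (simp add: C_def right_diff_distrib sum_subtractf del: sum.lessThan_Suc)
qed simp

text \<open>Bathtub principle: with weights at most 1 and a budget of \<open>r\<close>, it is best
  to put full weight on the \<open>r\<close> largest values. The \<open>min\<close> covers budgets
  exceeding the number of values.\<close>

lemma sum_capped_weights_le:
  fixes x c :: "nat \<Rightarrow> real"
  assumes x: "antimono_on {..<d} x" "\<And>i. i < d \<Longrightarrow> 0 \<le> x i"
    and c: "\<And>i. i < d \<Longrightarrow> 0 \<le> c i" "\<And>i. i < d \<Longrightarrow> c i \<le> 1" "sum c {..<d} \<le> real r"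
  shows "(\<Sum>i<d. c i * x i) \<le> sum x {..<min r d}"
proof (cases "r = 0 \<or> d \<le> r")
  case True
  then show ?thesis
  proof
    assume r: "r = 0"
    then have "sum c {..<d} = 0" using c(1,3) by (intro antisym sum_nonneg) auto
    then have "\<forall>i\<in>{..<d}. c i = 0" using c(1) by (subst (asm) sum_nonneg_eq_0_iff) auto
    then show ?thesis using r by simp
  next
    assume "d \<le> r"
    moreover have "(\<Sum>i<d. c i * x i) \<le> (\<Sum>i<d. x i)"
      using x(2) c(1,2) by (intro sum_mono) (auto intro: mult_left_le_one_le)
    ultimately show ?thesis by simp
  qed
next
  case False
  then have r: "0 < r" "r < d" by auto
  \<comment> \<open>The smallest value that receives full weight. Up to it the coefficient is
    nonpositive and \<open>x i\<close> is at least \<open>y\<close>; beyond it both signs flip. So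
    replacing every \<open>x i\<close> by \<open>y\<close> can only increase the sum.\<close>
  define y where "y = x (r - 1)"
  have y0: "0 \<le> y" using x(2) r by (simp add: y_def)
  have "(\<Sum>i<d. (c i - (if i < r then 1 else 0)) * x i) \<le> (\<Sum>i<d. (c i - (if i < r then 1 else 0)) * y)"
  proof (rule sum_mono)
    fix i assume "i \<in> {..<d}"
    then have i: "i < d" by simp
    show "(c i - (if i < r then 1 else 0)) * x i \<le> (c i - (if i < r then 1 else 0)) * y"
    proof (cases "i < r")
      case True
      then have "y \<le> x i" unfolding y_def using r by (intro monotone_onD[OF x(1)]) auto
      then show ?thesis using c(2)[OF i] True by (auto intro: mult_left_mono_neg)
    next
      case False
      then have "x i \<le> y" unfolding y_def using r i by (intro monotone_onD[OF x(1)]) auto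
      then show ?thesis using c(1)[OF i] False by (auto intro: mult_left_mono)
    qed
  qed
  also have "\<dots> = (sum c {..<d} - real r) * y"
  proof -
    have "{..<d} \<inter> {i. i < r} = {..<r}" using r by auto
    then show ?thesis by (simp add: sum_subtractf sum.If_cases flip: sum_distrib_right)
  qed
  also have "\<dots> \<le> 0" using c(3) y0 by (intro mult_nonpos_nonneg) auto
  finally have "(\<Sum>i<d. c i * x i) \<le> (\<Sum>i<d. (if i < r then 1 else 0) * x i)"
    by (simp add: left_diff_distrib sum_subtractf)
  also have "(\<Sum>i<d. (if i < r then 1 else 0) * x i) = (\<Sum>i<d. if i < r then x i else 0)"
    by (intro sum.cong) auto
  also have "\<dots> = sum x {..<min r d}"
  proof -
    have "{..<d} \<inter> {i. i < r} = {..<r}" using r by auto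
    then show ?thesis using r by (simp add: sum.If_cases)
  qed
  finally show ?thesis .
qed

text \<open>The image of \<open>x\<close> under \<open>S\<close> is majorized by \<open>x\<close>:
  its prefix sum of length \<open>k\<close> puts on \<open>x j\<close> a partial column sum of
  \<open>S\<close>, at most 1 and of total \<open>k\<close>, so the bathtub principle
  applies.\<close>

lemma doubly_stochastic_sum_ge:
  fixes S :: "nat \<Rightarrow> nat \<Rightarrow> real"
  assumes f: "mono_on {..<d} f" and x: "antimono_on {..<d} x" "\<And>i. i < d \<Longrightarrow> 0 \<le> x i"
    and S: "\<And>i j. i < d \<Longrightarrow> j < d \<Longrightarrow> 0 \<le> S i j"
    and rows: "\<And>i. i < d \<Longrightarrow> (\<Sum>j<d. S i j) = 1"
    and cols: "\<And>j. j < d \<Longrightarrow> (\<Sum>i<d. S i j) = 1"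
  shows "(\<Sum>i<d. f i * x i) \<le> (\<Sum>i<d. f i * (\<Sum>j<d. S i j * x j))"
proof (rule sum_mono_weights_le[OF f])
  show "sum x {..<d} = (\<Sum>i<d. \<Sum>j<d. S i j * x j)"
    by (subst sum.swap) (simp add: cols flip: sum_distrib_right)
next
  fix k assume k: "k < d"
  have "(\<Sum>i<k. \<Sum>j<d. S i j * x j) = (\<Sum>j<d. (\<Sum>i<k. S i j) * x j)"
    by (subst sum.swap) (simp flip: sum_distrib_right)
  also have "\<dots> \<le> sum x {..<min k d}"
  proof (rule sum_capped_weights_le[OF x])
    fix j assume j: "j < d"
    show "0 \<le> (\<Sum>i<k. S i j)" using S j k by (intro sum_nonneg) auto
    have "(\<Sum>i<k. S i j) \<le> (\<Sum>i<d. S i j)" using S j k by (intro sum_mono2) auto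
    then show "(\<Sum>i<k. S i j) \<le> 1" using cols[OF j] by simp
  next
    have "(\<Sum>j<d. \<Sum>i<k. S i j) = (\<Sum>i<k. 1)"
      using k by (subst sum.swap) (intro sum.cong, auto simp: rows)
    then show "(\<Sum>j<d. \<Sum>i<k. S i j) \<le> real k" by simp
  qed simp_all
  finally show "(\<Sum>i<k. \<Sum>j<d. S i j * x j) \<le> sum x {..<k}" using k by simp
qed

section \<open>Spectral decompositions and passive energy\<close>

lemma mat_trace_mult_commute:
  assumes "A \<in> carrier_mat n m" "B \<in> carrier_mat m n"
  shows "mat_trace (A * B) = mat_trace (B * A)"
proof -
  have "mat_trace (A * B) = (\<Sum>i<n. \<Sum>k<m. A $$ (i, k) * B $$ (k, i))"
    unfolding mat_trace_def using assms
    by (intro sum.cong) (auto simp: index_mult_mat_sum[OF assms] simp del: index_mult_mat(1))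
  also have "\<dots> = (\<Sum>k<m. \<Sum>i<n. B $$ (k, i) * A $$ (i, k))"
    by (subst sum.swap) (simp add: mult.commute)
  also have "\<dots> = mat_trace (B * A)"
    unfolding mat_trace_def using assms
    by (intro sum.cong) (auto simp: index_mult_mat_sum[OF assms(2,1)] simp del: index_mult_mat(1))
  finally show ?thesis .
qed

text \<open>Column \<open>k\<close> of \<open>U\<close> is an eigenvector for \<open>e k\<close>.
  Fixing the order of the eigenvalues allows sortedness to be imposed on \<open>e\<close>.\<close>

definition diagonalized :: "nat \<Rightarrow> complex mat \<Rightarrow> complex mat \<Rightarrow> (nat \<Rightarrow> real) \<Rightarrow> bool" where
  "diagonalized d A U e \<longleftrightarrow> U \<in> unitary_mats d \<and>
     A = U * mat_diag d (\<lambda>i. complex_of_real (e i)) * mat_adjoint U"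

lemma diagonalized_carrier:
  assumes "diagonalized d A U e"
  shows "A \<in> carrier_mat d d" "U \<in> unitary_mats d" "U \<in> carrier_mat d d"
  using assms by (auto simp: diagonalized_def unitary_mats_def)

lemma diagonalized_entry:
  assumes A: "diagonalized d A U e" and ij: "i < d" "j < d"
  shows "A $$ (i, j) = (\<Sum>k<d. complex_of_real (e k) * U $$ (i, k) * cnj (U $$ (j, k)))"
proof -
  note u = diagonalized_carrier[OF A]
  have "A = mat d d (\<lambda>(i, j). U $$ (i, j) * complex_of_real (e j)) * mat_adjoint U"
    using A mat_diag_mult_right[OF u(3)] by (simp add: diagonalized_def)
  then show ?thesis using u ij
    by (subst (asm) mat_eq_iff) (auto simp: index_mult_mat_sum[of _ d d _ d] simp del: index_mult_mat(1) intro!: sum.cong)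
qed

lemma diagonalizedI_entry:
  assumes U: "U \<in> unitary_mats d" and A: "A \<in> carrier_mat d d"
    and e: "\<And>i j. i < d \<Longrightarrow> j < d \<Longrightarrow>
      A $$ (i, j) = (\<Sum>k<d. complex_of_real (e k) * U $$ (i, k) * cnj (U $$ (j, k)))"
  shows "diagonalized d A U e"
proof -
  define B where "B = U * mat_diag d (\<lambda>i. complex_of_real (e i)) * mat_adjoint U"
  have B: "diagonalized d B U e" using U by (simp add: diagonalized_def B_def)
  have "A = B"
    using A diagonalized_carrier[OF B] by (intro eq_matI) (auto simp: diagonalized_entry[OF B] e)
  then show ?thesis using B by simp
qed

text \<open>The spectra of the Hamiltonians are given relative to the ground energy; adding the
  scalar back keeps the eigenvectors.\<close>

lemma diagonalized_shift:
  assumes A: "A \<in> carrier_mat d d" and D: "diagonalized d (A - complex_of_real c \<cdot>\<^sub>m 1\<^sub>m d) U e"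
  shows "diagonalized d A U (\<lambda>i. e i + c)"
proof (rule diagonalizedI_entry[OF diagonalized_carrier(2)[OF D] A])
  fix i j assume ij: "i < d" "j < d"
  have "A $$ (i, j) = (A - complex_of_real c \<cdot>\<^sub>m 1\<^sub>m d) $$ (i, j) + complex_of_real c * (if i = j then 1 else 0)"
    using A ij by auto
  also have "(if i = j then 1 else 0) = (\<Sum>k<d. U $$ (i, k) * cnj (U $$ (j, k)))"
    using unitary_rows_orthonormal[OF diagonalized_carrier(2)[OF D] ij] by simp
  finally show "A $$ (i, j) = (\<Sum>k<d. complex_of_real (e k + c) * U $$ (i, k) * cnj (U $$ (j, k)))"
    using diagonalized_entry[OF D ij] by (simp add: sum_distrib_left sum.distrib algebra_simps)
qed

lemma diagonalized_mult_col:
  assumes A: "diagonalized d A U e" and "i < d" "j < d"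
  shows "(\<Sum>k<d. A $$ (i, k) * U $$ (k, j)) = complex_of_real (e j) * U $$ (i, j)"
proof -
  note u = diagonalized_carrier[OF A]
  have "(\<Sum>k<d. A $$ (i, k) * U $$ (k, j)) =
      (\<Sum>k<d. \<Sum>l<d. complex_of_real (e l) * U $$ (i, l) * (cnj (U $$ (k, l)) * U $$ (k, j)))"
    using assms by (intro sum.cong) (auto simp: diagonalized_entry sum_distrib_right mult.assoc)
  also have "\<dots> = (\<Sum>l<d. complex_of_real (e l) * U $$ (i, l) * (if l = j then 1 else 0))"
    using assms by (subst sum.swap) (auto simp: unitary_cols_orthonormal[OF u(2)] simp flip: sum_distrib_left intro!: sum.cong)
  also have "\<dots> = complex_of_real (e j) * U $$ (i, j)"
    using assms by (subst sum.remove[of _ j]) auto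
  finally show ?thesis .
qed

lemma diagonalized_conj:
  assumes A: "diagonalized d A U e" and "i < d" "j < d"
  shows "(\<Sum>k<d. \<Sum>l<d. cnj (U $$ (k, i)) * A $$ (k, l) * U $$ (l, j)) = (if i = j then complex_of_real (e i) else 0)"
proof -
  have "(\<Sum>k<d. \<Sum>l<d. cnj (U $$ (k, i)) * A $$ (k, l) * U $$ (l, j)) =
      (\<Sum>k<d. cnj (U $$ (k, i)) * (complex_of_real (e j) * U $$ (k, j)))"
    using assms by (intro sum.cong) (simp_all add: mult.assoc diagonalized_mult_col flip: sum_distrib_left)
  also have "\<dots> = complex_of_real (e j) * (\<Sum>k<d. cnj (U $$ (k, i)) * U $$ (k, j))"
    by (simp add: sum_distrib_left mult_ac)
  finally show ?thesis using unitary_cols_orthonormal[OF diagonalized_carrier(2)[OF A] assms(2,3)] by simp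
qed

lemma diagonalized_unitary_conj:
  assumes A: "diagonalized d A V e" and U: "U \<in> unitary_mats d"
  shows "diagonalized d (U * A * mat_adjoint U) (U * V) e"
proof -
  note u = unitary_matsD[OF U] and v = unitary_matsD[OF diagonalized_carrier(2)[OF A]]
  have "U * (V * mat_diag d (\<lambda>i. complex_of_real (e i)) * mat_adjoint V) * mat_adjoint U =
      U * V * mat_diag d (\<lambda>i. complex_of_real (e i)) * mat_adjoint (U * V)"
    using u v mat_diag_dim[of d "\<lambda>i. complex_of_real (e i)"]
    by (simp add: mat_adjoint_mult[of _ d d _ d] assoc_mult_mat[of _ d d _ d _ d]
        mult_carrier_mat[of _ d d _ d])
  then show ?thesis using A U unitary_mats_mult[OF U] by (auto simp: diagonalized_def)
qed

text \<open>The entries of \<open>mat_adjoint Q * V\<close> are the overlaps of the eigenvectors of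
  \<open>H\<close> with those of \<open>A\<close>. Their squared moduli form a doubly stochastic
  matrix, which brings energies under \<open>doubly_stochastic_sum_ge\<close>.\<close>

lemma trace_diagonalized_mult:
  assumes A: "diagonalized d A V x" and H: "diagonalized d H Q h"
  shows "mat_trace (A * H) =
    complex_of_real (\<Sum>i<d. h i * (\<Sum>j<d. (cmod ((mat_adjoint Q * V) $$ (i, j)))\<^sup>2 * x j))"
proof -
  note v = unitary_matsD[OF diagonalized_carrier(2)[OF A]]
    and q = unitary_matsD[OF diagonalized_carrier(2)[OF H]]
  let ?x = "mat_diag d (\<lambda>i. complex_of_real (x i))" and ?h = "mat_diag d (\<lambda>i. complex_of_real (h i))"
  define M where "M = mat_adjoint Q * V"
  have M: "M \<in> carrier_mat d d" "mat_adjoint M \<in> carrier_mat d d" using v q by (auto simp: M_def)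
  have "mat_trace (A * H) = mat_trace (V * (?x * (mat_adjoint V * Q * ?h * mat_adjoint Q)))"
    using A H v q mat_diag_dim[of d "\<lambda>i. complex_of_real (x i)"] mat_diag_dim[of d "\<lambda>i. complex_of_real (h i)"]
    by (simp add: diagonalized_def assoc_mult_mat[of _ d d _ d _ d] mult_carrier_mat[of _ d d _ d])
  \<comment> \<open>Moving \<open>V\<close> to the right end by cyclicity joins the two basis
    changes into \<open>M\<close> and its adjoint.\<close>
  also have "\<dots> = mat_trace (?x * (mat_adjoint V * Q * ?h * mat_adjoint Q) * V)"
    using v q mat_diag_dim[of d "\<lambda>i. complex_of_real (x i)"] mat_diag_dim[of d "\<lambda>i. complex_of_real (h i)"]
    by (intro mat_trace_mult_commute[of _ d d]) (auto simp: mult_carrier_mat[of _ d d _ d])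
  also have "?x * (mat_adjoint V * Q * ?h * mat_adjoint Q) * V = ?x * (mat_adjoint M * (?h * M))"
    unfolding M_def
    using v q mat_diag_dim[of d "\<lambda>i. complex_of_real (x i)"] mat_diag_dim[of d "\<lambda>i. complex_of_real (h i)"]
    by (simp add: mat_adjoint_mult[of _ d d _ d] assoc_mult_mat[of _ d d _ d _ d] mult_carrier_mat[of _ d d _ d])
  also have "mat_trace \<dots> = (\<Sum>j<d. complex_of_real (x j) * (\<Sum>i<d. cnj (M $$ (i, j)) * (complex_of_real (h i) * M $$ (i, j))))"
  proof -
    have hM: "?h * M = mat d d (\<lambda>(i, j). complex_of_real (h i) * M $$ (i, j))"
      by (rule mat_diag_mult_left[OF M(1)])
    have c: "mat_adjoint M * (?h * M) \<in> carrier_mat d d"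
      unfolding hM using M by (intro mult_carrier_mat[of _ d d]) auto
    show ?thesis unfolding mat_trace_def mat_diag_mult_left[OF c] using M c
      by (auto simp: hM index_mult_mat_sum[of _ d d _ d] simp del: index_mult_mat(1) intro!: sum.cong)
  qed
  also have "\<dots> = (\<Sum>j<d. \<Sum>i<d. complex_of_real (h i * ((cmod (M $$ (i, j)))\<^sup>2 * x j)))"
    unfolding sum_distrib_left
    by (intro sum.cong refl) (simp add: complex_norm_square mult_ac del: of_real_power)
  also have "\<dots> = complex_of_real (\<Sum>i<d. h i * (\<Sum>j<d. (cmod (M $$ (i, j)))\<^sup>2 * x j))"
    by (subst sum.swap) (simp add: sum_distrib_left)
  finally show ?thesis by (simp add: M_def)
qed

lemma trace_diagonalized:
  assumes A: "diagonalized d A V x"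
  shows "mat_trace A = complex_of_real (sum x {..<d})"
proof -
  note v = diagonalized_carrier[OF A]
  have "mat_trace A = (\<Sum>i<d. \<Sum>k<d. complex_of_real (x k) * (cnj (V $$ (i, k)) * V $$ (i, k)))"
    unfolding mat_trace_def using v by (intro sum.cong) (auto simp: diagonalized_entry[OF A] mult_ac)
  also have "\<dots> = (\<Sum>k<d. complex_of_real (x k))"
    by (subst sum.swap) (auto simp: unitary_cols_orthonormal[OF v(2)] simp flip: sum_distrib_left intro!: sum.cong)
  finally show ?thesis by simp
qed

text \<open>Conjugation by \<open>U\<close> keeps the spectrum and changes only the overlaps. Double
  stochasticity makes the oppositely sorted pairing a lower bound, and aligning the eigenbases
  attains it.\<close>

lemma passive_energy:
  assumes A: "diagonalized d A V x" and H: "diagonalized d H Q h"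
    and x: "antimono_on {..<d} x" "\<And>i. i < d \<Longrightarrow> 0 \<le> x i" and h: "mono_on {..<d} h"
  shows "(INF U \<in> unitary_mats d. energy H (U * A * mat_adjoint U)) = (\<Sum>i<d. h i * x i)"
proof (rule cInf_eq_minimum)
  note v = diagonalized_carrier[OF A] and q = diagonalized_carrier[OF H]
  note vv = unitary_matsD[OF v(2)] and qq = unitary_matsD[OF q(2)]
  \<comment> \<open>This unitary sends the eigenvectors of \<open>A\<close> to those of
    \<open>H\<close> in order, so the overlap matrix becomes the identity.\<close>
  define U where "U = Q * mat_adjoint V"
  have U: "U \<in> unitary_mats d" unfolding U_def by (intro unitary_mats_mult q unitary_mats_adjoint v)
  have "mat_adjoint Q * (U * V) = 1\<^sub>m d"
    unfolding U_def using vv qq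
    by (simp add: assoc_mult_mat[of _ d d _ d _ d] mult_carrier_mat[of _ d d _ d])
  then have "energy H (U * A * mat_adjoint U) = (\<Sum>i<d. h i * x i)"
    unfolding energy_def trace_diagonalized_mult[OF diagonalized_unitary_conj[OF A U] H]
    by (auto simp: if_distrib[of "\<lambda>z. z * _"] if_distrib[of "\<lambda>z. z ^ 2"] if_distrib[of cmod] cong: if_cong intro!: sum.cong)
  then show "(\<Sum>i<d. h i * x i) \<in> (\<lambda>U. energy H (U * A * mat_adjoint U)) ` unitary_mats d"
    using U by (intro image_eqI[of _ _ U]) auto
next
  fix y assume "y \<in> (\<lambda>U. energy H (U * A * mat_adjoint U)) ` unitary_mats d"
  then obtain U where U: "U \<in> unitary_mats d" and y: "y = energy H (U * A * mat_adjoint U)" by auto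
  define M where "M = mat_adjoint Q * (U * V)"
  have M: "M \<in> unitary_mats d" unfolding M_def
    by (intro unitary_mats_mult unitary_mats_adjoint U diagonalized_carrier(2)[OF A] diagonalized_carrier(2)[OF H])
  have "y = (\<Sum>i<d. h i * (\<Sum>j<d. (cmod (M $$ (i, j)))\<^sup>2 * x j))"
    unfolding y energy_def trace_diagonalized_mult[OF diagonalized_unitary_conj[OF A U] H] M_def by simp
  moreover have "(\<Sum>i<d. h i * x i) \<le> \<dots>"
  proof (rule doubly_stochastic_sum_ge[OF h x])
    fix i assume i: "i < d"
    show "(\<Sum>j<d. (cmod (M $$ (i, j)))\<^sup>2) = 1"
      using unitary_rows_orthonormal[OF M i i]
      by (simp flip: complex_norm_square of_real_sum of_real_power)
    show "(\<Sum>j<d. (cmod (M $$ (j, i)))\<^sup>2) = 1"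
      using unitary_cols_orthonormal[OF M i i]
      by (simp add: mult.commute[of "cnj _"] flip: complex_norm_square of_real_sum of_real_power)
  qed auto
  ultimately show "(\<Sum>i<d. h i * x i) \<le> y" by simp
qed

section \<open>Spectra of Hermitian matrices and of states\<close>

lemma eigenvalues_of_diagonalized:
  assumes A: "A \<in> carrier_mat d d" "mat_adjoint A = A" and e: "eigenvalues_of A e"
  obtains U where "diagonalized d A U e"
proof -
  define es where "es = map (\<lambda>i. complex_of_real (e i)) [0..<d]"
  have "char_poly A = (\<Prod>e\<leftarrow>es. [:- e, 1:])"
    using e A prod.distinct_set_conv_list[of "[0..<d]" "\<lambda>i. [:- complex_of_real (e i), 1:]"]
    unfolding eigenvalues_of_def es_def by (simp add: lessThan_atLeast0 o_def)
  then obtain U where U: "U \<in> unitary_mats d" "A = U * mat_diag d (\<lambda>i. es ! i) * mat_adjoint U"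
    using hermitian_unitary_diagonal_list[OF A] by auto
  moreover have "mat_diag d (\<lambda>i. es ! i) = mat_diag d (\<lambda>i. complex_of_real (e i))"
    by (rule eq_matI) (auto simp: mat_diag_def es_def)
  ultimately show ?thesis using that by (simp add: diagonalized_def)
qed

text \<open>Factoring the characteristic polynomial gives complex eigenvalues; the diagonal matrix
  is unitarily conjugate to \<open>A\<close>, hence Hermitian, so its entries are real.\<close>

lemma hermitian_diagonalized:
  assumes A: "A \<in> carrier_mat d d" "mat_adjoint A = A"
  obtains U e where "diagonalized d A U e"
proof -
  obtain es where es: "char_poly A = (\<Prod>a\<leftarrow>es. [:- a, 1:])"
    using char_poly_factorized[OF A(1)] by blast
  define D where "D = mat_diag d (\<lambda>i. es ! i)"
  have D: "D \<in> carrier_mat d d" by (simp add: D_def)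
  obtain U where U: "U \<in> unitary_mats d" and AU: "A = U * D * mat_adjoint U"
    using hermitian_unitary_diagonal_list[OF A es] by (auto simp: D_def)
  note u = unitary_matsD[OF U]
  have DA: "D = mat_adjoint U * A * U"
    using unitary_conj_cancel[OF unitary_mats_adjoint[OF U] D] AU by simp
  have "mat_adjoint D = D"
    unfolding DA using u A
    by (simp add: mat_adjoint_mult[of _ d d _ d] assoc_mult_mat[of _ d d _ d _ d] mult_carrier_mat[of _ d d _ d])
  then have "cnj (D $$ (i, i)) = D $$ (i, i)" if "i < d" for i
    using that D index_mat_adjoint[of i D i] by simp
  then have "cnj (es ! i) = es ! i" if "i < d" for i
    using that by (simp add: D_def mat_diag_def)
  then have "D = mat_diag d (\<lambda>i. complex_of_real (Re (es ! i)))"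
    by (intro eq_matI) (auto simp: D_def mat_diag_def complex_eq_iff)
  then show ?thesis using that U AU by (auto simp: diagonalized_def)
qed

text \<open>The quadratic form of \<open>A\<close> takes the value \<open>e k\<close> at column
  \<open>k\<close> of \<open>U\<close>.\<close>

lemma positive_semidefinite_eigenvalue_nonneg:
  assumes A: "diagonalized d A U e" and psd: "positive_semidefinite A" and k: "k < d"
  shows "0 \<le> e k"
proof -
  note u = diagonalized_carrier[OF A]
  have "(A *\<^sub>v col U k) \<bullet>c col U k = (\<Sum>i<d. (\<Sum>l<d. A $$ (i, l) * U $$ (l, k)) * cnj (U $$ (i, k)))"
    using u k by (auto simp: scalar_prod_def conjugate_complex_def lessThan_atLeast0 intro!: sum.cong)
  also have "\<dots> = complex_of_real (e k) * (\<Sum>i<d. cnj (U $$ (i, k)) * U $$ (i, k))"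
    unfolding sum_distrib_left using k by (intro sum.cong) (auto simp: diagonalized_mult_col[OF A])
  also have "\<dots> = complex_of_real (e k)" using unitary_cols_orthonormal[OF u(2) k k] by simp
  finally show ?thesis using psd u k unfolding positive_semidefinite_def
    by (metis Re_complex_of_real carrier_matD(1) col_carrier_vec carrier_matD(2))
qed

lemma qubit_state_diagonalized:
  assumes "qubit_state Y \<sigma>"
  obtains U e where "diagonalized (2 ^ card Y) \<sigma> U e" "\<And>i. i < 2 ^ card Y \<Longrightarrow> 0 \<le> e i"
    "(\<Sum>i<2 ^ card Y. e i) = 1"
proof -
  have s: "\<sigma> \<in> carrier_mat (2 ^ card Y) (2 ^ card Y)" "positive_semidefinite \<sigma>" "mat_trace \<sigma> = 1"
    "mat_adjoint \<sigma> = \<sigma>"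
    using assms by (auto simp: qubit_state_def positive_semidefinite_def)
  obtain U e where D: "diagonalized (2 ^ card Y) \<sigma> U e" using hermitian_diagonalized[OF s(1,4)] by blast
  moreover have "(\<Sum>i<2 ^ card Y. e i) = 1"
    using trace_diagonalized[OF D] s(3) by (metis of_real_eq_1_iff)
  ultimately show ?thesis using that positive_semidefinite_eigenvalue_nonneg[OF D s(2)] by blast
qed

section \<open>Tensor factors, marginals and the Hamiltonian\<close>

text \<open>Positions strictly increase along \<open>Y\<close> and stay below \<open>card Y\<close>,
  so they are distinct and exhaust the range by counting.\<close>

lemma bij_betw_qubit_pos:
  assumes "finite Y"
  shows "bij_betw (qubit_pos Y) Y {..<card Y}"
proof -
  have less: "qubit_pos Y l < qubit_pos Y l'" if "l \<in> Y" "l < l'" for l l'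
    unfolding qubit_pos_def using assms that by (intro psubset_card_mono) auto
  have inj: "inj_on (qubit_pos Y) Y"
    by (rule inj_onI) (metis less less_irrefl linorder_neqE_nat)
  have "qubit_pos Y l < card Y" if "l \<in> Y" for l
    unfolding qubit_pos_def using assms that by (intro psubset_card_mono) auto
  then have "qubit_pos Y ` Y = {..<card Y}"
    using card_image[OF inj] by (intro card_subset_eq) auto
  then show ?thesis using inj by (simp add: bij_betw_def)
qed

text \<open>Reindexing the qubits by position gives a binary expansion, whose bits can be read
  off.\<close>

lemma restrict_index_horner_sum:
  assumes "finite Z"
  shows "restrict_index Y Z k = horner_sum of_bool 2
    (map (\<lambda>p. bit k (qubit_pos Y (inv_into Z (qubit_pos Z) p))) [0..<card Z])"
proof -
  note bij = bij_betw_qubit_pos[OF assms]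
  have "restrict_index Y Z k = (\<Sum>l\<in>Z. of_bool (bit k (qubit_pos Y (inv_into Z (qubit_pos Z) (qubit_pos Z l)))) * 2 ^ qubit_pos Z l)"
    unfolding restrict_index_def using bij_betw_inv_into_left[OF bij] by (intro sum.cong) auto
  also have "\<dots> = (\<Sum>p<card Z. of_bool (bit k (qubit_pos Y (inv_into Z (qubit_pos Z) p))) * 2 ^ p)"
    by (rule sum.reindex_bij_betw[OF bij])
  finally show ?thesis by (simp add: horner_sum_eq_sum lessThan_atLeast0)
qed

lemma bit_restrict_index:
  assumes "finite Z" "l \<in> Z"
  shows "bit (restrict_index Y Z k) (qubit_pos Z l) \<longleftrightarrow> bit k (qubit_pos Y l)"
  using bij_betw_apply[OF bij_betw_qubit_pos[OF assms(1)] assms(2)]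
    bij_betw_inv_into_left[OF bij_betw_qubit_pos[OF assms(1)] assms(2)]
  by (simp add: restrict_index_horner_sum[OF assms(1)] bit_horner_sum_bit_iff)

lemma restrict_index_less:
  assumes "finite Z"
  shows "restrict_index Y Z k < 2 ^ card Z"
proof -
  have "take_bit (card Z) (restrict_index Y Z k) = restrict_index Y Z k"
    unfolding restrict_index_horner_sum[OF assms]
    by (rule bit_eqI) (auto simp: bit_take_bit_iff bit_horner_sum_bit_iff)
  then show ?thesis by (simp add: take_bit_nat_eq_self_iff)
qed

text \<open>The tensor factorization at the level of basis indices. It is injective because each bit
  below \<open>card Y\<close> belongs to a qubit of \<open>Z\<close> or of \<open>Y - Z\<close>, and
  onto by counting.\<close>

lemma bij_betw_restrict_index:
  assumes Y: "finite Y" "Z \<subseteq> Y"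
  shows "bij_betw (\<lambda>k. (restrict_index Y Z k, restrict_index Y (Y - Z) k)) {..<2 ^ card Y}
    ({..<2 ^ card Z} \<times> {..<2 ^ card (Y - Z)})"
proof -
  let ?f = "\<lambda>k. (restrict_index Y Z k, restrict_index Y (Y - Z) k)"
  have Z: "finite Z" "finite (Y - Z)" using Y finite_subset by auto
  have inj: "inj_on ?f {..<2 ^ card Y}"
  proof (rule inj_onI)
    fix k k' assume k: "k \<in> {..<2 ^ card Y}" "k' \<in> {..<2 ^ card Y}" and eq: "?f k = ?f k'"
    have b: "bit k (qubit_pos Y l) = bit k' (qubit_pos Y l)" if "l \<in> Y" for l
      using eq that bit_restrict_index[OF Z(1), of l Y k] bit_restrict_index[OF Z(1), of l Y k']
        bit_restrict_index[OF Z(2), of l Y k] bit_restrict_index[OF Z(2), of l Y k']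
      by (cases "l \<in> Z") auto
    have "take_bit (card Y) k = take_bit (card Y) k'"
    proof (rule bit_eqI)
      fix p
      show "bit (take_bit (card Y) k) p = bit (take_bit (card Y) k') p"
      proof (cases "p < card Y")
        case True
        then obtain l where "l \<in> Y" "p = qubit_pos Y l"
          using bij_betw_imp_surj_on[OF bij_betw_qubit_pos[OF Y(1)]] by (metis imageE lessThan_iff)
        then show ?thesis using b by (simp add: bit_take_bit_iff)
      qed (simp add: bit_take_bit_iff)
    qed
    then show "k = k'" using k by (simp add: take_bit_nat_eq_self)
  qed
  moreover have "?f ` {..<2 ^ card Y} = {..<2 ^ card Z} \<times> {..<2 ^ card (Y - Z)}"
  proof (rule card_subset_eq)
    show "?f ` {..<2 ^ card Y} \<subseteq> {..<2 ^ card Z} \<times> {..<2 ^ card (Y - Z)}"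
      using restrict_index_less[OF Z(1)] restrict_index_less[OF Z(2)] by auto
    have "card Y = card Z + card (Y - Z)"
      using Y Z by (metis card_Diff_subset card_mono le_add_diff_inverse)
    then show "card (?f ` {..<2 ^ card Y}) = card ({..<(2::nat) ^ card Z} \<times> {..<(2::nat) ^ card (Y - Z)})"
      using card_image[OF inj] by (simp add: power_add)
  qed simp
  ultimately show ?thesis by (simp add: bij_betw_def)
qed

text \<open>The inverse of the splitting of indices: the basis vector with part \<open>i\<close> on
  \<open>Z\<close> and part \<open>b\<close> on \<open>Y - Z\<close>. It is meaningful only for
  \<open>i\<close> and \<open>b\<close> in range.\<close>

definition merge_index :: "nat set \<Rightarrow> nat set \<Rightarrow> nat \<Rightarrow> nat \<Rightarrow> nat" where
  "merge_index Y Z i b =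
     inv_into {..<2 ^ card Y} (\<lambda>k. (restrict_index Y Z k, restrict_index Y (Y - Z) k)) (i, b)"

lemma merge_index:
  assumes "finite Y" "Z \<subseteq> Y" "i < 2 ^ card Z" "b < 2 ^ card (Y - Z)"
  shows "merge_index Y Z i b < 2 ^ card Y"
    "restrict_index Y Z (merge_index Y Z i b) = i"
    "restrict_index Y (Y - Z) (merge_index Y Z i b) = b"
proof -
  note bij = bij_betw_restrict_index[OF assms(1,2)]
  have p: "(i, b) \<in> {..<2 ^ card Z} \<times> {..<2 ^ card (Y - Z)}" using assms by auto
  show "merge_index Y Z i b < 2 ^ card Y"
    using bij_betw_apply[OF bij_betw_inv_into[OF bij] p] by (simp add: merge_index_def)
  show "restrict_index Y Z (merge_index Y Z i b) = i" "restrict_index Y (Y - Z) (merge_index Y Z i b) = b"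
    using bij_betw_inv_into_right[OF bij p] by (auto simp: merge_index_def)
qed

lemma merge_restrict_index:
  assumes "finite Y" "Z \<subseteq> Y" "k < 2 ^ card Y"
  shows "merge_index Y Z (restrict_index Y Z k) (restrict_index Y (Y - Z) k) = k"
  using bij_betw_inv_into_left[OF bij_betw_restrict_index[OF assms(1,2)], of k] assms(3)
  by (simp add: merge_index_def)

lemma sum_merge_index:
  assumes "finite Y" "Z \<subseteq> Y"
  shows "(\<Sum>k<2 ^ card Y. f k) = (\<Sum>i<2 ^ card Z. \<Sum>b<2 ^ card (Y - Z). f (merge_index Y Z i b))"
proof -
  have "(\<Sum>k<2 ^ card Y. f k) =
      (\<Sum>p\<in>{..<2 ^ card Z} \<times> {..<2 ^ card (Y - Z)}. f (case p of (i, b) \<Rightarrow> merge_index Y Z i b))"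
    unfolding merge_index_def case_prod_eta
    by (intro sum.reindex_bij_betw[symmetric] bij_betw_inv_into bij_betw_restrict_index[OF assms])
  then show ?thesis by (simp add: sum.cartesian_product split_def)
qed

text \<open>The pairs summed over in the definition agree on the traced out qubits, so their common
  value \<open>b\<close> there enumerates them.\<close>

lemma reduced_op_entry:
  assumes Y: "finite Y" "Z \<subseteq> Y" and i: "i < 2 ^ card Z" and j: "j < 2 ^ card Z"
  shows "reduced_op Y Z A $$ (i, j) =
    (\<Sum>b<2 ^ card (Y - Z). A $$ (merge_index Y Z i b, merge_index Y Z j b))"
proof -
  have "finite (Y - Z)" using Y by simp
  note less = restrict_index_less[OF this]
  have "reduced_op Y Z A $$ (i, j) = (\<Sum>(k, k') | k < 2 ^ card Y \<and> k' < 2 ^ card Y \<and>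
                restrict_index Y Z k = i \<and> restrict_index Y Z k' = j \<and>
                restrict_index Y (Y - Z) k = restrict_index Y (Y - Z) k'. A $$ (k, k'))"
    using i j by (simp add: reduced_op_def)
  also have "\<dots> = (\<Sum>b<2 ^ card (Y - Z). A $$ (merge_index Y Z i b, merge_index Y Z j b))"
    using i j less
    by (intro sum.reindex_bij_witness[where
          i = "\<lambda>b. (merge_index Y Z i b, merge_index Y Z j b)" and
          j = "\<lambda>(k, k'). restrict_index Y (Y - Z) k"])
      (auto simp: merge_index[OF Y] merge_restrict_index[OF Y], (metis merge_restrict_index[OF Y])+)
  finally show ?thesis .
qed

lemma reduced_op_carrier: "reduced_op Y Z A \<in> carrier_mat (2 ^ card Z) (2 ^ card Z)"
  by (simp add: reduced_op_def)

text \<open>For \<open>f\<close> constantly 1 this is preservation of the trace; for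
  \<open>f\<close> the levels of \<open>Z\<close> it computes the energy of the marginal.\<close>

lemma sum_diag_reduced_op:
  assumes "finite Y" "Z \<subseteq> Y"
  shows "(\<Sum>i<2 ^ card Z. reduced_op Y Z A $$ (i, i) * f i) =
    (\<Sum>k<2 ^ card Y. A $$ (k, k) * f (restrict_index Y Z k))"
  unfolding sum_merge_index[OF assms]
  by (intro sum.cong) (auto simp: reduced_op_entry[OF assms] merge_index[OF assms] sum_distrib_right)

section \<open>The Hamiltonian and its levels\<close>

definition level :: "(nat \<Rightarrow> real) \<Rightarrow> (nat \<Rightarrow> real) \<Rightarrow> nat set \<Rightarrow> nat \<Rightarrow> real" where
  "level E \<alpha> Y k = (\<Sum>l\<in>Y. E l + (if bit k (qubit_pos Y l) then \<alpha> l else 0))"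

text \<open>Every local term is diagonal in the computational basis, so the levels add up qubit by
  qubit. They appear in the order of the basis indices, not sorted.\<close>

lemma hamiltonian_eq_mat_diag:
  assumes Y: "finite Y"
  shows "hamiltonian E \<alpha> Y = mat_diag (2 ^ card Y) (\<lambda>k. complex_of_real (level E \<alpha> Y k))"
proof (rule eq_matI)
  fix i j assume "i < dim_row (mat_diag (2 ^ card Y) (\<lambda>k. complex_of_real (level E \<alpha> Y k)))"
    "j < dim_col (mat_diag (2 ^ card Y) (\<lambda>k. complex_of_real (level E \<alpha> Y k)))"
  then have ij: "i < 2 ^ card Y" "j < 2 ^ card Y" by (auto simp: mat_diag_def)
  have t: "tensor_op Y {l} (local_hamiltonian E \<alpha> l) (1\<^sub>m (2 ^ card (Y - {l}))) $$ (i, j) =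
      (if i = j then complex_of_real (E l + (if bit i (qubit_pos Y l) then \<alpha> l else 0)) else 0)"
    if l: "l \<in> Y" for l
  proof -
    have Z: "finite (Y - {l})" "{l} \<subseteq> Y" using Y l by auto
    have "qubit_pos {l} l = 0" by (auto simp: qubit_pos_def)
    then have r: "restrict_index Y {l} k = (if bit k (qubit_pos Y l) then 1 else 0)" for k
      by (simp add: restrict_index_def)
    \<comment> \<open>Distinct indices differ at qubit \<open>l\<close> or on the rest, so either
      the local Hamiltonian or the identity factor makes an off-diagonal entry 0.\<close>
    have "i = j \<longleftrightarrow> restrict_index Y {l} i = restrict_index Y {l} j \<and>
        restrict_index Y (Y - {l}) i = restrict_index Y (Y - {l}) j"
      using inj_onD[OF bij_betw_imp_inj_on[OF bij_betw_restrict_index[OF Y Z(2)]], of i j] ij by auto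
    then show ?thesis using ij restrict_index_less[OF Z(1)] r
      by (auto simp: tensor_op_def local_hamiltonian_def mat_diag_def)
  qed
  have "hamiltonian E \<alpha> Y $$ (i, j) =
      (\<Sum>l\<in>Y. if i = j then complex_of_real (E l + (if bit i (qubit_pos Y l) then \<alpha> l else 0)) else 0)"
    unfolding hamiltonian_def by (subst index_mat(1)[OF ij], intro sum.cong refl t)
  then show "hamiltonian E \<alpha> Y $$ (i, j) = mat_diag (2 ^ card Y) (\<lambda>k. complex_of_real (level E \<alpha> Y k)) $$ (i, j)"
    using ij by (auto simp: mat_diag_def level_def)
qed (auto simp: hamiltonian_def mat_diag_def)

lemma level_split:
  assumes Y: "finite Y" "Z \<subseteq> Y"
  shows "level E \<alpha> Y k = level E \<alpha> Z (restrict_index Y Z k) + level E \<alpha> (Y - Z) (restrict_index Y (Y - Z) k)"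
proof -
  have Z: "finite Z" "finite (Y - Z)" using Y finite_subset by auto
  show ?thesis unfolding level_def sum.subset_diff[OF Y(2,1)]
    using bit_restrict_index[OF Z(1), of _ Y k] bit_restrict_index[OF Z(2), of _ Y k]
    by (auto intro!: sum.cong)
qed

lemma energy_mat_diag:
  assumes "A \<in> carrier_mat d d"
  shows "energy (mat_diag d h) A = Re (\<Sum>i<d. A $$ (i, i) * h i)"
  unfolding energy_def mat_trace_def mat_diag_mult_right[OF assms] by simp

text \<open>Only the diagonal of \<open>A\<close> enters, and each level of \<open>Y\<close> is the
  sum of the levels of its two parts.\<close>

lemma energy_hamiltonian_split:
  assumes Y: "finite Y" "Z \<subseteq> Y" and A: "A \<in> carrier_mat (2 ^ card Y) (2 ^ card Y)"
  shows "energy (hamiltonian E \<alpha> Y) A =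
    energy (hamiltonian E \<alpha> Z) (reduced_op Y Z A) +
    energy (hamiltonian E \<alpha> (Y - Z)) (reduced_op Y (Y - Z) A)"
proof -
  have Z: "finite Z" "finite (Y - Z)" "Y - Z \<subseteq> Y" using Y finite_subset by auto
  show ?thesis
    unfolding Y(1)[THEN hamiltonian_eq_mat_diag] Z(1,2)[THEN hamiltonian_eq_mat_diag]
    by (simp add: energy_mat_diag[OF A] energy_mat_diag[OF reduced_op_carrier]
        sum_diag_reduced_op[OF Y] sum_diag_reduced_op[OF Y(1) Z(3)] level_split[OF Y]
        sum.distrib distrib_left del: Re_sum)
qed

lemma level_ge_ground_energy:
  assumes "\<And>l. l \<in> Y \<Longrightarrow> 0 \<le> \<alpha> l"
  shows "ground_energy E Y \<le> level E \<alpha> Y k" "level E \<alpha> Y 0 = ground_energy E Y"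
  using assms by (auto simp: level_def ground_energy_def sum.distrib intro!: sum_nonneg)

lemma hamiltonian_hermitian:
  assumes "finite Y"
  shows "hamiltonian E \<alpha> Y \<in> carrier_mat (2 ^ card Y) (2 ^ card Y)"
    "mat_adjoint (hamiltonian E \<alpha> Y) = hamiltonian E \<alpha> Y"
  by (auto simp: hamiltonian_eq_mat_diag[OF assms] mat_adjoint_mat_diag)

text \<open>Both sides are the root set of the characteristic polynomial. Comparing sets is enough
  to locate the smallest eigenvalue.\<close>

lemma eigenvalues_of_mat_diag:
  assumes "eigenvalues_of (mat_diag d (\<lambda>i. complex_of_real (h i))) e"
  shows "e ` {..<d} = h ` {..<d}"
proof -
  let ?D = "mat_diag d (\<lambda>i. complex_of_real (h i))"
  have "char_poly ?D = (\<Prod>a\<leftarrow>diag_mat ?D. [:- a, 1:])"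
    by (rule char_poly_upper_triangular[of _ d]) (auto simp: mat_diag_def)
  moreover have "set (diag_mat ?D) = (\<lambda>i. complex_of_real (h i)) ` {..<d}"
    by (auto simp: diag_mat_def mat_diag_def)
  ultimately have "poly (char_poly ?D) z = 0 \<longleftrightarrow> z \<in> (\<lambda>i. complex_of_real (h i)) ` {..<d}" for z
    by (auto simp: poly_prod_list prod_list_zero_iff)
  moreover have "poly (char_poly ?D) z = 0 \<longleftrightarrow> z \<in> (\<lambda>i. complex_of_real (e i)) ` {..<d}" for z
    using assms by (auto simp: eigenvalues_of_def poly_prod mat_diag_def)
  ultimately have "complex_of_real ` (e ` {..<d}) = complex_of_real ` (h ` {..<d})"
    by (auto simp: image_image)
  then show ?thesis by (simp add: inj_image_eq_iff inj_of_real)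
qed

text \<open>Levels relative to the ground energy are nonnegative and vanish at index 0, where all
  qubits are in the ground state; an increasing list of the same values must start with 0.\<close>

lemma shifted_hamiltonian_ground_eigenvalue:
  assumes Y: "finite Y" and \<alpha>: "\<And>l. l \<in> Y \<Longrightarrow> 0 \<le> \<alpha> l"
    and e: "eigenvalues_of (hamiltonian E \<alpha> Y - complex_of_real (ground_energy E Y) \<cdot>\<^sub>m 1\<^sub>m (2 ^ card Y)) e"
    and mono: "mono_on {..<2 ^ card Y} e"
  shows "e 0 = 0"
proof -
  define h where "h k = level E \<alpha> Y k - ground_energy E Y" for k
  have "hamiltonian E \<alpha> Y - complex_of_real (ground_energy E Y) \<cdot>\<^sub>m 1\<^sub>m (2 ^ card Y) =
      mat_diag (2 ^ card Y) (\<lambda>k. complex_of_real (h k))"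
    unfolding hamiltonian_eq_mat_diag[OF Y] by (rule eq_matI) (auto simp: mat_diag_def h_def)
  with e have im: "e ` {..<2 ^ card Y} = h ` {..<2 ^ card Y}"
    using eigenvalues_of_mat_diag[of "2 ^ card Y" h e] by (simp only:)
  have h: "0 \<le> h k" "h 0 = 0" for k using level_ge_ground_energy[of Y \<alpha>, OF \<alpha>] by (auto simp: h_def)
  have "0 \<le> e 0" using im h(1) by (metis (no_types, lifting) imageE imageI lessThan_iff zero_less_numeral zero_less_power)
  moreover obtain i where "i < 2 ^ card Y" "e i = 0"
    using im h(2) by (metis (no_types, lifting) imageE imageI lessThan_iff zero_less_numeral zero_less_power)
  then have "e 0 \<le> 0" using monotone_onD[OF mono, of 0 i] by auto
  ultimately show ?thesis by simp
qed

section \<open>Separable states\<close>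

lemma sum_rotate: "(\<Sum>i\<in>A. \<Sum>j\<in>B. \<Sum>k\<in>C. f i j k) = (\<Sum>j\<in>B. \<Sum>k\<in>C. \<Sum>i\<in>A. f i j k)"
  by (subst sum.swap) (rule sum.cong[OF refl sum.swap])

text \<open>The coefficients are taken without conjugation, so \<open>p\<close> is the orthogonal
  projection of \<open>y\<close> onto the span of the conjugates of the \<open>u j\<close>. The
  bound is the nonnegativity of the squared norm of \<open>y - p\<close>.\<close>

lemma bessel_inequality:
  fixes u :: "'j \<Rightarrow> 'w \<Rightarrow> complex"
  assumes J: "finite J"
    and on: "\<And>j j'. j \<in> J \<Longrightarrow> j' \<in> J \<Longrightarrow> (\<Sum>w\<in>W. u j w * cnj (u j' w)) = (if j = j' then 1 else 0)"
  shows "(\<Sum>j\<in>J. (cmod (\<Sum>w\<in>W. u j w * y w))\<^sup>2) \<le> (\<Sum>w\<in>W. (cmod (y w))\<^sup>2)"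
proof -
  define a where "a j = (\<Sum>w\<in>W. u j w * y w)" for j
  define p where "p w = (\<Sum>j\<in>J. a j * cnj (u j w))" for w
  define S where "S = (\<Sum>j\<in>J. a j * cnj (a j))"
  have yp: "(\<Sum>w\<in>W. y w * cnj (p w)) = S"
  proof -
    have "(\<Sum>w\<in>W. y w * cnj (p w)) = (\<Sum>w\<in>W. \<Sum>j\<in>J. cnj (a j) * (u j w * y w))"
      by (simp add: p_def sum_distrib_left mult_ac)
    also have "\<dots> = (\<Sum>j\<in>J. cnj (a j) * a j)"
      by (subst sum.swap) (simp add: a_def flip: sum_distrib_left)
    finally show ?thesis by (simp add: S_def mult.commute)
  qed
  have S_real: "cnj S = S" by (simp add: S_def mult.commute)
  have py: "(\<Sum>w\<in>W. p w * cnj (y w)) = S"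
    using arg_cong[OF yp, of cnj] by (simp add: S_real mult.commute)
  have pp: "(\<Sum>w\<in>W. p w * cnj (p w)) = S"
  proof -
    have "(\<Sum>w\<in>W. p w * cnj (p w)) =
        (\<Sum>w\<in>W. \<Sum>j\<in>J. \<Sum>j'\<in>J. a j * cnj (a j') * (u j' w * cnj (u j w)))"
      by (simp add: p_def sum_distrib_left sum_distrib_right mult_ac) (subst (2) sum.swap, simp)
    also have "\<dots> = (\<Sum>j\<in>J. \<Sum>j'\<in>J. a j * cnj (a j') * (\<Sum>w\<in>W. u j' w * cnj (u j w)))"
      by (subst sum.swap, intro sum.cong refl, subst sum.swap) (simp add: sum_distrib_left)
    also have "\<dots> = (\<Sum>j\<in>J. \<Sum>j'\<in>J. if j' = j then a j * cnj (a j') else 0)"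
      by (intro sum.cong refl) (simp add: on)
    also have "\<dots> = S" using J by (simp add: S_def)
    finally show ?thesis .
  qed
  have "complex_of_real (\<Sum>w\<in>W. (cmod (y w - p w))\<^sup>2) = (\<Sum>w\<in>W. (y w - p w) * cnj (y w - p w))"
    by (simp add: complex_norm_square del: of_real_power)
  also have "\<dots> = (\<Sum>w\<in>W. y w * cnj (y w)) - S"
    using yp py pp by (simp add: algebra_simps sum.distrib sum_subtractf)
  also have "\<dots> = complex_of_real ((\<Sum>w\<in>W. (cmod (y w))\<^sup>2) - (\<Sum>j\<in>J. (cmod (a j))\<^sup>2))"
    by (simp add: S_def complex_norm_square del: of_real_power)
  finally have "(\<Sum>w\<in>W. (cmod (y w - p w))\<^sup>2) = (\<Sum>w\<in>W. (cmod (y w))\<^sup>2) - (\<Sum>j\<in>J. (cmod (a j))\<^sup>2)"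
    by (simp only: of_real_eq_iff)
  moreover have "(\<Sum>w\<in>W. (cmod (y w - p w))\<^sup>2) \<ge> 0" by (simp add: sum_nonneg)
  ultimately show ?thesis by (simp add: a_def)
qed

text \<open>Core of the majorization: \<open>w\<close> labels product vectors, \<open>j\<close>
  eigenvectors of the global state and \<open>i\<close> those of the marginal. The weight
  \<open>c i\<close> is the sum over \<open>J\<close> of a column of the substochastic matrix
  relating the two spectra.\<close>

lemma product_ensemble_weights:
  fixes u :: "'j \<Rightarrow> 'w \<Rightarrow> complex" and a :: "'w \<Rightarrow> 'i \<Rightarrow> complex" and b :: "'w \<Rightarrow> 'b \<Rightarrow> complex"
    and x :: "'i \<Rightarrow> real"
  assumes fin: "finite J" "finite W" "finite I" "finite B"
    and u: "\<And>j j'. j \<in> J \<Longrightarrow> j' \<in> J \<Longrightarrow> (\<Sum>w\<in>W. u j w * cnj (u j' w)) = (if j = j' then 1 else 0)"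
    and b: "\<And>w. w \<in> W \<Longrightarrow> (\<Sum>\<beta>\<in>B. (cmod (b w \<beta>))\<^sup>2) = 1"
    and a: "\<And>i i'. i \<in> I \<Longrightarrow> i' \<in> I \<Longrightarrow>
      (\<Sum>w\<in>W. a w i * cnj (a w i')) = (if i = i' then complex_of_real (x i) else 0)"
  obtains c where "\<And>i. i \<in> I \<Longrightarrow> 0 \<le> c i" "\<And>i. i \<in> I \<Longrightarrow> c i \<le> 1" "sum c I \<le> real (card J)"
    "(\<Sum>j\<in>J. \<Sum>i\<in>I. \<Sum>\<beta>\<in>B. (cmod (\<Sum>w\<in>W. u j w * a w i * b w \<beta>))\<^sup>2) = (\<Sum>i\<in>I. c i * x i)"
proof -
  define g where "g i = (\<Sum>j\<in>J. \<Sum>\<beta>\<in>B. (cmod (\<Sum>w\<in>W. u j w * a w i * b w \<beta>))\<^sup>2)" for i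
  \<comment> \<open>If \<open>x i = 0\<close>, then \<open>g i = 0\<close> by the bound
    \<open>gx\<close> below, so the default 0 keeps \<open>g i = c i * x i\<close> true.\<close>
  define c where "c i = (if x i = 0 then 0 else g i / x i)" for i
  have x: "x i = (\<Sum>w\<in>W. (cmod (a w i))\<^sup>2)" if "i \<in> I" for i
    using a[OF that that] by (simp flip: complex_norm_square of_real_sum of_real_power)
  then have x0: "0 \<le> x i" if "i \<in> I" for i using that by (simp add: sum_nonneg)
  have g0: "0 \<le> g i" for i by (simp add: g_def sum_nonneg)
  \<comment> \<open>First use of Bessel, with the system \<open>u\<close>, for each fixed \<beta>;
    the unit norm of \<open>b w\<close> then removes the sum over \<beta>.\<close>
  have gx: "g i \<le> x i" if i: "i \<in> I" for i
  proof -
    have "g i = (\<Sum>\<beta>\<in>B. \<Sum>j\<in>J. (cmod (\<Sum>w\<in>W. u j w * (a w i * b w \<beta>)))\<^sup>2)"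
      unfolding g_def by (subst sum.swap) (simp add: mult.assoc)
    also have "\<dots> \<le> (\<Sum>\<beta>\<in>B. \<Sum>w\<in>W. (cmod (a w i * b w \<beta>))\<^sup>2)"
      by (intro sum_mono bessel_inequality fin u)
    also have "\<dots> = (\<Sum>w\<in>W. (cmod (a w i))\<^sup>2 * (\<Sum>\<beta>\<in>B. (cmod (b w \<beta>))\<^sup>2))"
      by (subst sum.swap) (simp add: norm_mult power_mult_distrib sum_distrib_left)
    also have "\<dots> = x i" using b x[OF i] by simp
    finally show ?thesis .
  qed
  have gc: "g i = c i * x i" if "i \<in> I" for i
    using gx[OF that] g0[of i] by (auto simp: c_def)
  define I' where "I' = {i \<in> I. x i \<noteq> 0}"
  have I': "finite I'" "I' \<subseteq> I" using fin by (auto simp: I'_def)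
  \<comment> \<open>As vectors in \<open>w\<close>, the \<open>a w i\<close> for different
    \<open>i\<close> are orthogonal with squared length \<open>x i\<close>. The nonzero ones,
    normalized, are the second orthonormal system.\<close>
  define v where "v i w = a w i / complex_of_real (sqrt (x i))" for i w
  have v: "(\<Sum>w\<in>W. v i w * cnj (v i' w)) = (if i = i' then 1 else 0)" if "i \<in> I'" "i' \<in> I'" for i i'
  proof -
    have "(\<Sum>w\<in>W. v i w * cnj (v i' w)) =
        (\<Sum>w\<in>W. a w i * cnj (a w i')) / complex_of_real (sqrt (x i) * sqrt (x i'))"
      by (simp add: v_def sum_divide_distrib)
    also have "\<dots> = (if i = i' then 1 else 0)"
    proof -
      have "sqrt (x i) * sqrt (x i) = x i" using x0[of i] that I' by auto
      then show ?thesis using that a[of i i'] by (auto simp: I'_def simp flip: of_real_mult)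
    qed
    finally show ?thesis .
  qed
  have "sum c I = (\<Sum>i\<in>I'. g i / x i)"
    unfolding I'_def using fin by (intro sum.mono_neutral_cong_right) (auto simp: c_def)
  \<comment> \<open>Now \<open>u\<close> and \<open>a\<close> trade roles: the factor
    \<open>1 / x i\<close> normalizes \<open>a\<close> to \<open>v\<close>, and Bessel for
    \<open>v\<close> is applied to the products of \<open>u\<close> and \<open>b\<close>.\<close>
  also have "\<dots> = (\<Sum>i\<in>I'. \<Sum>j\<in>J. \<Sum>\<beta>\<in>B. (cmod (\<Sum>w\<in>W. v i w * (u j w * b w \<beta>)))\<^sup>2)"
  proof (rule sum.cong)
    fix i assume i: "i \<in> I'"
    then have "x i > 0" using x0[of i] by (auto simp: I'_def)
    moreover have "(\<Sum>w\<in>W. v i w * (u j w * b w \<beta>)) =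
        (\<Sum>w\<in>W. u j w * a w i * b w \<beta>) / complex_of_real (sqrt (x i))" for j \<beta>
      by (simp add: v_def sum_divide_distrib mult_ac)
    ultimately show "g i / x i = (\<Sum>j\<in>J. \<Sum>\<beta>\<in>B. (cmod (\<Sum>w\<in>W. v i w * (u j w * b w \<beta>)))\<^sup>2)"
      by (simp add: g_def norm_divide power_divide flip: sum_divide_distrib)
  qed simp
  also have "\<dots> = (\<Sum>j\<in>J. \<Sum>\<beta>\<in>B. \<Sum>i\<in>I'. (cmod (\<Sum>w\<in>W. v i w * (u j w * b w \<beta>)))\<^sup>2)"
    by (subst sum.swap, intro sum.cong refl, rule sum.swap)
  also have "\<dots> \<le> (\<Sum>j\<in>J. \<Sum>\<beta>\<in>B. \<Sum>w\<in>W. (cmod (u j w * b w \<beta>))\<^sup>2)"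
    by (intro sum_mono bessel_inequality I' v)
  also have "\<dots> = (\<Sum>j\<in>J. \<Sum>w\<in>W. (cmod (u j w))\<^sup>2 * (\<Sum>\<beta>\<in>B. (cmod (b w \<beta>))\<^sup>2))"
    by (intro sum.cong refl, subst sum.swap) (simp add: norm_mult power_mult_distrib sum_distrib_left)
  also have "\<dots> = (\<Sum>j\<in>J. 1)"
  proof (intro sum.cong refl)
    fix j assume j: "j \<in> J"
    have "(\<Sum>w\<in>W. (cmod (u j w))\<^sup>2) = 1"
      using u[OF j j] by (simp flip: complex_norm_square of_real_sum of_real_power)
    then show "(\<Sum>w\<in>W. (cmod (u j w))\<^sup>2 * (\<Sum>\<beta>\<in>B. (cmod (b w \<beta>))\<^sup>2)) = 1" using b by simp
  qed
  finally have "sum c I \<le> real (card J)" by simp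
  moreover have "(\<Sum>j\<in>J. \<Sum>i\<in>I. \<Sum>\<beta>\<in>B. (cmod (\<Sum>w\<in>W. u j w * a w i * b w \<beta>))\<^sup>2) = (\<Sum>i\<in>I. c i * x i)"
    using gc by (subst sum.swap) (simp add: g_def)
  moreover have "0 \<le> c i" "c i \<le> 1" if "i \<in> I" for i
    using gx[OF that] g0[of i] x0[OF that] by (auto simp: c_def divide_le_eq_1)
  ultimately show ?thesis using that by blast
qed

text \<open>A triple consists of a component of the mixture, an eigenvector of its \<sigma> and one
  of its \<tau>. All weights go into \<open>a\<close> as square roots, so the \<open>b w\<close> are
  unit vectors and tracing them out leaves only the \<open>a w\<close>.\<close>

lemma separable_product_ensemble:
  assumes Y: "finite Y" "X \<subseteq> Y" and sep: "separable_across Y X \<rho>"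
  obtains W :: "(nat \<times> nat \<times> nat) set" and a b :: "nat \<times> nat \<times> nat \<Rightarrow> nat \<Rightarrow> complex"
  where "finite W" "\<And>w. w \<in> W \<Longrightarrow> (\<Sum>\<beta><2 ^ card (Y - X). (cmod (b w \<beta>))\<^sup>2) = 1"
    "\<And>k k'. k < 2 ^ card Y \<Longrightarrow> k' < 2 ^ card Y \<Longrightarrow> \<rho> $$ (k, k') =
      (\<Sum>w\<in>W. a w (restrict_index Y X k) * b w (restrict_index Y (Y - X) k) *
        cnj (a w (restrict_index Y X k') * b w (restrict_index Y (Y - X) k')))"
    "\<And>i j. i < 2 ^ card X \<Longrightarrow> j < 2 ^ card X \<Longrightarrow>
      reduced_op Y X \<rho> $$ (i, j) = (\<Sum>w\<in>W. a w i * cnj (a w j))"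
proof -
  have X: "finite X" "finite (Y - X)" using Y finite_subset by auto
  let ?dX = "2 ^ card X :: nat" and ?dC = "2 ^ card (Y - X) :: nat" and ?dY = "2 ^ card Y :: nat"
  let ?r = "restrict_index Y X" and ?r' = "restrict_index Y (Y - X)"
  obtain K :: nat and p \<sigma> \<tau> where p: "\<And>k. k < K \<Longrightarrow> 0 \<le> p k"
    and \<sigma>: "\<And>k. k < K \<Longrightarrow> qubit_state X (\<sigma> k)" and \<tau>: "\<And>k. k < K \<Longrightarrow> qubit_state (Y - X) (\<tau> k)"
    and \<rho>: "\<rho> = mat ?dY ?dY (\<lambda>ij. \<Sum>k<K. complex_of_real (p k) * tensor_op Y X (\<sigma> k) (\<tau> k) $$ ij)"
    using sep unfolding separable_across_def by blast
  have "\<exists>S \<nu>. k < K \<longrightarrow> diagonalized ?dX (\<sigma> k) S \<nu> \<and> (\<forall>i<?dX. 0 \<le> \<nu> i)" for k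
    by (metis qubit_state_diagonalized[OF \<sigma>])
  then obtain S \<nu> where S: "\<And>k. k < K \<Longrightarrow> diagonalized ?dX (\<sigma> k) (S k) (\<nu> k)"
    and \<nu>: "\<And>k i. k < K \<Longrightarrow> i < ?dX \<Longrightarrow> 0 \<le> \<nu> k i" by metis
  have "\<exists>T \<mu>. k < K \<longrightarrow> diagonalized ?dC (\<tau> k) T \<mu> \<and> (\<forall>i<?dC. 0 \<le> \<mu> i)" for k
    by (metis qubit_state_diagonalized[OF \<tau>])
  then obtain T \<mu> where T: "\<And>k. k < K \<Longrightarrow> diagonalized ?dC (\<tau> k) (T k) (\<mu> k)"
    and \<mu>: "\<And>k i. k < K \<Longrightarrow> i < ?dC \<Longrightarrow> 0 \<le> \<mu> k i" by metis
  define W where "W = {..<K} \<times> {..<?dX} \<times> {..<?dC}"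
  define a where "a = (\<lambda>(q, s, r) i. complex_of_real (sqrt (p q * \<nu> q s * \<mu> q r)) * S q $$ (i, s))"
  define b where "b = (\<lambda>(q, s :: nat, r) \<beta>. T q $$ (\<beta>, r))"
  have W: "finite W" by (simp add: W_def)
  have b1: "(\<Sum>\<beta><?dC. (cmod (b w \<beta>))\<^sup>2) = 1" if wW: "w \<in> W" for w
  proof -
    obtain q s r where w: "w = (q, s, r)" "q < K" "r < ?dC" using wW by (auto simp: W_def)
    have "(\<Sum>\<beta><?dC. cnj (T q $$ (\<beta>, r)) * T q $$ (\<beta>, r)) = 1"
      using unitary_cols_orthonormal[OF diagonalized_carrier(2)[OF T[OF w(2)]] w(3) w(3)] by simp
    then show ?thesis
      by (simp add: w b_def mult.commute[of "cnj _"] flip: complex_norm_square of_real_sum of_real_power)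
  qed
  have \<rho>_entry: "\<rho> $$ (k, k') = (\<Sum>w\<in>W. a w (?r k) * b w (?r' k) * cnj (a w (?r k') * b w (?r' k')))"
    if k: "k < ?dY" "k' < ?dY" for k k'
  proof -
    have "\<rho> $$ (k, k') = (\<Sum>q<K. complex_of_real (p q) * (\<sigma> q $$ (?r k, ?r k') * \<tau> q $$ (?r' k, ?r' k')))"
      using k by (simp add: \<rho> tensor_op_def)
    also have "\<dots> = (\<Sum>q<K. \<Sum>s<?dX. \<Sum>r<?dC. complex_of_real (p q * \<nu> q s * \<mu> q r) *
        (S q $$ (?r k, s) * cnj (S q $$ (?r k', s)) * (T q $$ (?r' k, r) * cnj (T q $$ (?r' k', r)))))"
      by (intro sum.cong refl)
        (simp add: diagonalized_entry[OF S] diagonalized_entry[OF T] restrict_index_less X sum_product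
          sum_distrib_left mult_ac, rule sum.swap)
    also have "\<dots> = (\<Sum>q<K. \<Sum>s<?dX. \<Sum>r<?dC. a (q, s, r) (?r k) * b (q, s, r) (?r' k) *
        cnj (a (q, s, r) (?r k') * b (q, s, r) (?r' k')))"
    proof (intro sum.cong refl)
      fix q s r assume "q \<in> {..<K}" "s \<in> {..<?dX}" "r \<in> {..<?dC}"
      then have "0 \<le> p q * \<nu> q s * \<mu> q r" using p \<nu> \<mu> by simp
      then have "complex_of_real (p q * \<nu> q s * \<mu> q r) =
          complex_of_real (sqrt (p q * \<nu> q s * \<mu> q r)) * complex_of_real (sqrt (p q * \<nu> q s * \<mu> q r))"
        by (simp flip: of_real_mult)
      then show "complex_of_real (p q * \<nu> q s * \<mu> q r) *
          (S q $$ (?r k, s) * cnj (S q $$ (?r k', s)) * (T q $$ (?r' k, r) * cnj (T q $$ (?r' k', r)))) =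
          a (q, s, r) (?r k) * b (q, s, r) (?r' k) * cnj (a (q, s, r) (?r k') * b (q, s, r) (?r' k'))"
        by (simp only: a_def b_def split complex_cnj_mult complex_cnj_complex_of_real mult_ac)
    qed
    finally show ?thesis by (simp add: W_def sum.cartesian_product split_def)
  qed
  moreover have "reduced_op Y X \<rho> $$ (i, j) = (\<Sum>w\<in>W. a w i * cnj (a w j))"
    if ij: "i < ?dX" "j < ?dX" for i j
  proof -
    have "reduced_op Y X \<rho> $$ (i, j) = (\<Sum>\<beta><?dC. \<Sum>w\<in>W. a w i * cnj (a w j) * (b w \<beta> * cnj (b w \<beta>)))"
      unfolding reduced_op_entry[OF Y ij]
      using ij by (intro sum.cong refl) (simp add: \<rho>_entry merge_index[OF Y] mult_ac)
    also have "\<dots> = (\<Sum>w\<in>W. a w i * cnj (a w j) * complex_of_real (\<Sum>\<beta><?dC. (cmod (b w \<beta>))\<^sup>2))"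
      by (subst sum.swap) (simp add: complex_norm_square sum_distrib_left del: of_real_power)
    finally show ?thesis by (simp add: b1)
  qed
  ultimately show ?thesis using that W b1 by blast
qed

text \<open>Parseval's identity for the orthonormal basis formed by the columns of
  \<open>F\<close>.\<close>

lemma unitary_adjoint_norm:
  assumes F: "F \<in> unitary_mats d"
  shows "(\<Sum>i<d. (cmod (\<Sum>k<d. cnj (F $$ (k, i)) * z k))\<^sup>2) = (\<Sum>k<d. (cmod (z k))\<^sup>2)"
proof -
  have "complex_of_real (\<Sum>i<d. (cmod (\<Sum>k<d. cnj (F $$ (k, i)) * z k))\<^sup>2) =
      (\<Sum>i<d. \<Sum>k<d. \<Sum>l<d. z k * cnj (z l) * (F $$ (l, i) * cnj (F $$ (k, i))))"
    by (simp add: complex_norm_square sum_product mult_ac del: of_real_power)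
  also have "\<dots> = (\<Sum>k<d. \<Sum>l<d. z k * cnj (z l) * (\<Sum>i<d. F $$ (l, i) * cnj (F $$ (k, i))))"
    by (subst sum_rotate) (simp add: sum_distrib_left)
  also have "\<dots> = (\<Sum>k<d. \<Sum>l<d. if l = k then z k * cnj (z l) else 0)"
    by (intro sum.cong refl) (simp add: unitary_rows_orthonormal[OF F])
  also have "\<dots> = complex_of_real (\<Sum>k<d. (cmod (z k))\<^sup>2)"
    by (simp add: complex_norm_square del: of_real_power)
  finally show ?thesis by (simp only: of_real_eq_iff)
qed

text \<open>The eigenvectors of \<rho>, scaled by the roots of their eigenvalues, are combinations
  of product vectors with orthonormal coefficient systems. Their squared norms, expanded in the
  eigenbasis of the marginal, express \<open>t\<close> through \<open>x\<close> with weights to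
  which the bathtub principle applies.\<close>

lemma separable_spectrum_majorized:
  assumes Y: "finite Y" "X \<subseteq> Y" and sep: "separable_across Y X \<rho>"
    and G: "diagonalized (2 ^ card Y) \<rho> G t" and t: "\<And>j. j < 2 ^ card Y \<Longrightarrow> 0 \<le> t j"
    and F: "diagonalized (2 ^ card X) (reduced_op Y X \<rho>) F x" and x: "antimono_on {..<2 ^ card X} x"
  shows "i < 2 ^ card X \<Longrightarrow> 0 \<le> x i"
    and "r \<le> 2 ^ card Y \<Longrightarrow> sum t {..<r} \<le> sum x {..<min r (2 ^ card X)}"
proof -
  let ?dX = "2 ^ card X :: nat" and ?dC = "2 ^ card (Y - X) :: nat" and ?dY = "2 ^ card Y :: nat"
  let ?r = "restrict_index Y X" and ?r' = "restrict_index Y (Y - X)"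
  obtain W :: "(nat \<times> nat \<times> nat) set" and a b :: "nat \<times> nat \<times> nat \<Rightarrow> nat \<Rightarrow> complex"
    where W: "finite W" and b: "\<And>w. w \<in> W \<Longrightarrow> (\<Sum>\<beta><?dC. (cmod (b w \<beta>))\<^sup>2) = 1"
      and \<rho>: "\<And>k k'. k < ?dY \<Longrightarrow> k' < ?dY \<Longrightarrow> \<rho> $$ (k, k') =
        (\<Sum>w\<in>W. a w (?r k) * b w (?r' k) * cnj (a w (?r k') * b w (?r' k')))"
      and \<rho>X: "\<And>i j. i < ?dX \<Longrightarrow> j < ?dX \<Longrightarrow> reduced_op Y X \<rho> $$ (i, j) = (\<Sum>w\<in>W. a w i * cnj (a w j))"
    by (rule separable_product_ensemble[OF Y sep]) blast
  note f = diagonalized_carrier[OF F] and g = diagonalized_carrier[OF G]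
  \<comment> \<open>Coordinates of \<open>a w\<close> in the eigenbasis of the marginal, which is
    diagonal there; this yields the orthogonality required of \<open>a\<close> in
    \<open>product_ensemble_weights\<close>.\<close>
  define a' where "a' w i = (\<Sum>k<?dX. cnj (F $$ (k, i)) * a w k)" for w i
  have a': "(\<Sum>w\<in>W. a' w i * cnj (a' w j)) = (if i = j then complex_of_real (x i) else 0)"
    if ij: "i < ?dX" "j < ?dX" for i j
  proof -
    have "(\<Sum>w\<in>W. a' w i * cnj (a' w j)) =
        (\<Sum>w\<in>W. \<Sum>k<?dX. \<Sum>l<?dX. cnj (F $$ (k, i)) * (a w k * cnj (a w l)) * F $$ (l, j))"
      by (simp add: a'_def sum_product mult_ac)
    also have "\<dots> = (\<Sum>k<?dX. \<Sum>l<?dX. cnj (F $$ (k, i)) * reduced_op Y X \<rho> $$ (k, l) * F $$ (l, j))"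
      by (subst sum_rotate) (simp add: \<rho>X sum_distrib_left sum_distrib_right)
    finally show ?thesis using diagonalized_conj[OF F ij] by simp
  qed
  show x0: "0 \<le> x i" if "i < ?dX" for i
  proof -
    have "complex_of_real (x i) = complex_of_real (\<Sum>w\<in>W. (cmod (a' w i))\<^sup>2)"
      using a'[OF that that] by (simp add: complex_norm_square del: of_real_power)
    then have "x i = (\<Sum>w\<in>W. (cmod (a' w i))\<^sup>2)" by (simp only: of_real_eq_iff)
    then show ?thesis by (simp add: sum_nonneg)
  qed
  define c where "c w k = a w (?r k) * b w (?r' k)" for w k
  have \<rho>c: "\<rho> $$ (k, k') = (\<Sum>w\<in>W. c w k * cnj (c w k'))" if "k < ?dY" "k' < ?dY" for k k'
    using \<rho>[OF that] by (simp add: c_def)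
  \<comment> \<open>The overlap of eigenvector \<open>j\<close> with product vector
    \<open>w\<close>, scaled so that these are orthonormal in \<open>j\<close> as vectors in
    \<open>w\<close>.\<close>
  define u where "u j w = (\<Sum>k<?dY. cnj (c w k) * G $$ (k, j)) / complex_of_real (sqrt (t j))" for j w
  assume r: "r \<le> ?dY"
  \<comment> \<open>Zero eigenvalues are dropped to permit the division in \<open>u\<close>; they
    add nothing to the sum of \<open>t\<close>.\<close>
  define J where "J = {j. j < r \<and> 0 < t j}"
  have J: "finite J" "j \<in> J \<Longrightarrow> j < ?dY" "j \<in> J \<Longrightarrow> 0 < t j" for j using r by (auto simp: J_def)
  have u: "(\<Sum>w\<in>W. u j w * cnj (u j' w)) = (if j = j' then 1 else 0)" if j: "j \<in> J" "j' \<in> J" for j j'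
  proof -
    have "u j w * cnj (u j' w) =
        (\<Sum>k<?dY. \<Sum>l<?dY. cnj (G $$ (k, j')) * (c w k * cnj (c w l)) * G $$ (l, j)) /
          complex_of_real (sqrt (t j) * sqrt (t j'))" for w
    proof -
      have "u j w * cnj (u j' w) = (\<Sum>k<?dY. cnj (G $$ (k, j')) * c w k) * (\<Sum>l<?dY. cnj (c w l) * G $$ (l, j)) /
          complex_of_real (sqrt (t j) * sqrt (t j'))"
        by (simp add: u_def mult_ac)
      then show ?thesis by (simp only: sum_product mult.assoc)
    qed
    then have "(\<Sum>w\<in>W. u j w * cnj (u j' w)) =
        (\<Sum>w\<in>W. \<Sum>k<?dY. \<Sum>l<?dY. cnj (G $$ (k, j')) * (c w k * cnj (c w l)) * G $$ (l, j)) /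
          complex_of_real (sqrt (t j) * sqrt (t j'))"
      by (simp only: sum_divide_distrib)
    also have "(\<Sum>w\<in>W. \<Sum>k<?dY. \<Sum>l<?dY. cnj (G $$ (k, j')) * (c w k * cnj (c w l)) * G $$ (l, j)) =
        (\<Sum>k<?dY. \<Sum>l<?dY. cnj (G $$ (k, j')) * \<rho> $$ (k, l) * G $$ (l, j))"
      by (subst sum_rotate) (simp add: \<rho>c sum_distrib_left sum_distrib_right)
    also have "\<dots> = (if j = j' then complex_of_real (t j) else 0)"
      using diagonalized_conj[OF G J(2)[OF j(2)] J(2)[OF j(1)]] by auto
    finally show ?thesis using J(3)[OF j(1)] by (auto simp flip: of_real_mult)
  qed
  have tj: "(\<Sum>i<?dX. \<Sum>\<beta><?dC. (cmod (\<Sum>w\<in>W. u j w * a' w i * b w \<beta>))\<^sup>2) = t j" if j: "j \<in> J" for j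
  proof -
    \<comment> \<open>This is the eigenvector equation for \<rho> with \<rho> written as the
      ensemble: the coefficients \<open>u j\<close> recover eigenvector \<open>j\<close> with
      squared length \<open>t j\<close>.\<close>
    have uc: "(\<Sum>w\<in>W. u j w * c w k) = complex_of_real (sqrt (t j)) * G $$ (k, j)" if k: "k < ?dY" for k
    proof -
      have "(\<Sum>w\<in>W. u j w * c w k) =
          (\<Sum>w\<in>W. \<Sum>l<?dY. c w k * cnj (c w l) * G $$ (l, j)) / complex_of_real (sqrt (t j))"
        by (simp add: u_def sum_distrib_left sum_distrib_right sum_divide_distrib mult_ac)
      also have "(\<Sum>w\<in>W. \<Sum>l<?dY. c w k * cnj (c w l) * G $$ (l, j)) = (\<Sum>l<?dY. \<rho> $$ (k, l) * G $$ (l, j))"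
        using k by (subst sum.swap) (simp add: \<rho>c sum_distrib_right)
      also have "\<dots> = complex_of_real (t j) * G $$ (k, j)" by (rule diagonalized_mult_col[OF G k J(2)[OF j]])
      finally have "(\<Sum>w\<in>W. u j w * c w k) = complex_of_real (t j) * G $$ (k, j) / complex_of_real (sqrt (t j))" .
      moreover have "complex_of_real (t j) = complex_of_real (sqrt (t j)) * complex_of_real (sqrt (t j))"
        using J(3)[OF j] by (simp flip: of_real_mult)
      ultimately show ?thesis using J(3)[OF j] by simp
    qed
    \<comment> \<open>Undo the rotation of the X part, which preserves squared norms, and merge the
      two indices again.\<close>
    have "(\<Sum>i<?dX. \<Sum>\<beta><?dC. (cmod (\<Sum>w\<in>W. u j w * a' w i * b w \<beta>))\<^sup>2) =
        (\<Sum>\<beta><?dC. \<Sum>i<?dX. (cmod (\<Sum>k<?dX. cnj (F $$ (k, i)) * (\<Sum>w\<in>W. u j w * (a w k * b w \<beta>))))\<^sup>2)"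
    proof (subst sum.swap, intro sum.cong refl arg_cong[of _ _ "\<lambda>z. (cmod z)\<^sup>2"])
      fix \<beta> i
      show "(\<Sum>w\<in>W. u j w * a' w i * b w \<beta>) =
          (\<Sum>k<?dX. cnj (F $$ (k, i)) * (\<Sum>w\<in>W. u j w * (a w k * b w \<beta>)))"
        by (simp add: a'_def sum_distrib_left sum_distrib_right mult_ac) (rule sum.swap)
    qed
    also have "\<dots> = (\<Sum>\<beta><?dC. \<Sum>k<?dX. (cmod (\<Sum>w\<in>W. u j w * (a w k * b w \<beta>)))\<^sup>2)"
      by (simp only: unitary_adjoint_norm[OF f(2)])
    also have "\<dots> = (\<Sum>k<?dY. (cmod (\<Sum>w\<in>W. u j w * c w k))\<^sup>2)"
      unfolding sum_merge_index[OF Y] by (subst sum.swap) (simp add: c_def merge_index[OF Y])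
    also have "\<dots> = (\<Sum>k<?dY. t j * (cmod (G $$ (k, j)))\<^sup>2)"
      using J(3)[OF j] by (intro sum.cong refl) (simp add: uc norm_mult power_mult_distrib)
    also have "\<dots> = t j * (\<Sum>k<?dY. (cmod (G $$ (k, j)))\<^sup>2)" by (simp add: sum_distrib_left)
    also have "(\<Sum>k<?dY. (cmod (G $$ (k, j)))\<^sup>2) = 1"
      using unitary_cols_orthonormal[OF g(2) J(2)[OF j] J(2)[OF j]]
      by (simp add: mult.commute[of "cnj _"] flip: complex_norm_square of_real_sum of_real_power)
    finally show ?thesis by simp
  qed
  obtain v where v: "\<And>i. i < ?dX \<Longrightarrow> 0 \<le> v i" "\<And>i. i < ?dX \<Longrightarrow> v i \<le> 1"
    "sum v {..<?dX} \<le> real (card J)"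
    "(\<Sum>j\<in>J. \<Sum>i<?dX. \<Sum>\<beta><?dC. (cmod (\<Sum>w\<in>W. u j w * a' w i * b w \<beta>))\<^sup>2) = (\<Sum>i<?dX. v i * x i)"
    using product_ensemble_weights[of J W "{..<?dX}" "{..<?dC}" u b a' x] J(1) W u b a' by auto
  have "card J \<le> card {..<r}" by (intro card_mono) (auto simp: J_def)
  then have "sum v {..<?dX} \<le> real r" using v(3) by simp
  then have "(\<Sum>i<?dX. v i * x i) \<le> sum x {..<min r ?dX}"
    by (intro sum_capped_weights_le x x0 v)
  moreover have "sum t {..<r} = sum t J"
    using t r by (intro sum.mono_neutral_right) (auto simp: J_def less_le)
  ultimately show "sum t {..<r} \<le> sum x {..<min r ?dX}" using v(4) tj by simp
qed

section \<open>Ergotropy in terms of spectra, and the two bounds\<close>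

lemma ergotropy_hamiltonian:
  assumes Y: "finite Y"
    and h: "eigenvalues_of (hamiltonian E \<alpha> Y - complex_of_real (ground_energy E Y) \<cdot>\<^sub>m 1\<^sub>m (2 ^ card Y)) h"
      "mono_on {..<2 ^ card Y} h"
    and A: "diagonalized (2 ^ card Y) A V x"
    and x: "antimono_on {..<2 ^ card Y} x" "\<And>i. i < 2 ^ card Y \<Longrightarrow> 0 \<le> x i" "(\<Sum>i<2 ^ card Y. x i) = 1"
  shows "ergotropy (hamiltonian E \<alpha> Y) A =
    energy (hamiltonian E \<alpha> Y) A - (\<Sum>i<2 ^ card Y. h i * x i) - ground_energy E Y"
proof -
  let ?d = "2 ^ card Y" and ?H = "hamiltonian E \<alpha> Y" and ?g = "ground_energy E Y"
  note H = hamiltonian_hermitian[OF Y, of E \<alpha>]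
  let ?K = "?H - complex_of_real ?g \<cdot>\<^sub>m 1\<^sub>m ?d"
  have K: "?K \<in> carrier_mat ?d ?d" by (rule minus_carrier_mat) simp
  have "mat_adjoint ?K = ?K"
  proof (rule eq_matI)
    fix i j assume "i < dim_row ?K" "j < dim_col ?K"
    then have ij: "i < ?d" "j < ?d" using K by auto
    have "cnj (?H $$ (j, i)) = ?H $$ (i, j)"
      using arg_cong[OF H(2), of "\<lambda>M. M $$ (i, j)"] index_mat_adjoint[of i ?H j] H(1) ij by simp
    then show "mat_adjoint ?K $$ (i, j) = ?K $$ (i, j)" using ij H(1) by auto
  qed (use K in auto)
  then obtain Q where "diagonalized ?d ?K Q h" using eigenvalues_of_diagonalized[OF K] h(1) by blast
  from diagonalized_shift[OF H(1) this]
  have D: "diagonalized ?d ?H Q (\<lambda>i. h i + ?g)" .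
  have "(INF U \<in> unitary_mats ?d. energy ?H (U * A * mat_adjoint U)) = (\<Sum>i<?d. (h i + ?g) * x i)"
    using h(2) by (intro passive_energy[OF A D x(1,2)]) (auto simp: monotone_on_def)
  \<comment> \<open>Since \<open>x\<close> sums to 1, the shift by the ground energy becomes an
    additive constant.\<close>
  also have "\<dots> = (\<Sum>i<?d. h i * x i) + ?g"
    using x(3) by (simp add: distrib_right sum.distrib flip: sum_distrib_left)
  finally show ?thesis using H(1) by (simp add: ergotropy_def)
qed

theorem theorem1:
  fixes N \<kappa> :: nat and X :: "nat set" and E \<alpha> :: "nat \<Rightarrow> real"
    and \<rho> :: "complex mat" and n m t x :: "nat \<Rightarrow> real"
  assumes "2 \<le> N"
    and "X \<subseteq> {1..N}" and "card X = \<kappa>" and "\<kappa> \<in> {1..N - 1}"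
    and "\<And>l. l \<in> {1..N} \<Longrightarrow> 0 \<le> \<alpha> l"
    and "eigenvalues_of (hamiltonian E \<alpha> {1..N}
           - complex_of_real (ground_energy E {1..N}) \<cdot>\<^sub>m 1\<^sub>m (2 ^ N)) n"
    and "mono_on {..<2 ^ N} n"
    and "eigenvalues_of (hamiltonian E \<alpha> X
           - complex_of_real (ground_energy E X) \<cdot>\<^sub>m 1\<^sub>m (2 ^ \<kappa>)) m"
    and "mono_on {..<2 ^ \<kappa>} m"
    and "qubit_state {1..N} \<rho>" and "separable_across {1..N} X \<rho>"
    and "eigenvalues_of \<rho> t" and "antimono_on {..<2 ^ N} t"
    and "eigenvalues_of (reduced_op {1..N} X \<rho>) x" and "antimono_on {..<2 ^ \<kappa>} x"
  shows "ergotropic_gap E \<alpha> {1..N} X \<rho>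
           \<le> (\<Sum>i = 1..2 ^ \<kappa> - 1. (m i - m 1) * x i) + (\<Sum>i = 1..2 ^ N - 1. (m 1 - n i) * t i)
       \<and> ergotropic_gap E \<alpha> {1..N} X \<rho>
           \<le> (\<Sum>i = 1..2 ^ \<kappa> - 2. (m i - n i) * t i)
             + (\<Sum>i = 2 ^ \<kappa> - 1..2 ^ N - 1. (m (2 ^ \<kappa> - 1) - n i) * t i)"
proof -
  note N = assms(1) and X = assms(2) and \<kappa> = assms(3,4) and \<alpha> = assms(5) and n = assms(6,7)
    and m = assms(8,9) and \<rho> = assms(10) and sep = assms(11) and t = assms(12,13) and x = assms(14,15)
  let ?Y = "{1..N}"
  define D d :: nat where "D = 2 ^ N" and "d = 2 ^ \<kappa>"
  have cY: "card ?Y = N" "finite ?Y" by auto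
  have fX: "finite X" using X finite_subset by blast
  have \<alpha>X: "\<And>l. l \<in> X \<Longrightarrow> 0 \<le> \<alpha> l" using \<alpha> X by blast
  \<comment> \<open>The first fact makes 1 an index of \<open>m\<close>; the second leaves room for
    padding \<open>x\<close> by zeros.\<close>
  have d: "2 \<le> d" "d < D"
  proof -
    have "2 ^ 1 \<le> d" unfolding d_def using \<kappa>(2) by (intro power_increasing) auto
    then show "2 \<le> d" by simp
    show "d < D" unfolding d_def D_def using \<kappa>(2) by (intro power_strict_increasing) auto
  qed
  have st: "\<rho> \<in> carrier_mat D D" "positive_semidefinite \<rho>" "mat_trace \<rho> = 1" "mat_adjoint \<rho> = \<rho>"
    using \<rho> by (auto simp: qubit_state_def positive_semidefinite_def D_def)
  obtain G where G: "diagonalized D \<rho> G t" using eigenvalues_of_diagonalized[OF st(1,4) t(1)] .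
  have t0: "0 \<le> t j" if "j < D" for j by (rule positive_semidefinite_eigenvalue_nonneg[OF G st(2) that])
  have t1: "(\<Sum>i<D. t i) = 1" using trace_diagonalized[OF G] st(3) by (metis of_real_eq_1_iff)
  have red: "reduced_op ?Y X \<rho> \<in> carrier_mat d d" using reduced_op_carrier[of ?Y X \<rho>] \<kappa> by (simp add: d_def)
  have red_h: "mat_adjoint (reduced_op ?Y X \<rho>) = reduced_op ?Y X \<rho>"
  proof (rule eq_matI)
    fix i j assume "i < dim_row (reduced_op ?Y X \<rho>)" "j < dim_col (reduced_op ?Y X \<rho>)"
    then have ij: "i < d" "j < d" using red by auto
    then have ij': "i < 2 ^ card X" "j < 2 ^ card X" using \<kappa> by (auto simp: d_def)
    have "mat_adjoint (reduced_op ?Y X \<rho>) $$ (i, j) = cnj (reduced_op ?Y X \<rho> $$ (j, i))"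
      using ij red by simp
    moreover
    have "cnj (\<rho> $$ (k, l)) = \<rho> $$ (l, k)" if "k < D" "l < D" for k l
      using index_mat_adjoint[of l \<rho> k] st that by simp
    then have "cnj (reduced_op ?Y X \<rho> $$ (j, i)) = reduced_op ?Y X \<rho> $$ (i, j)"
      unfolding reduced_op_entry[OF cY(2) X ij'] reduced_op_entry[OF cY(2) X ij'(2,1)]
      using merge_index(1)[OF cY(2) X ij'(1)] merge_index(1)[OF cY(2) X ij'(2)]
      by (auto simp: D_def intro!: sum.cong)
    ultimately show "mat_adjoint (reduced_op ?Y X \<rho>) $$ (i, j) = reduced_op ?Y X \<rho> $$ (i, j)" by simp
  qed (use red in auto)
  obtain F where F: "diagonalized d (reduced_op ?Y X \<rho>) F x"
    using eigenvalues_of_diagonalized[OF red red_h x(1)] .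
  have maj: "i < d \<Longrightarrow> 0 \<le> x i" "r \<le> D \<Longrightarrow> sum t {..<r} \<le> sum x {..<min r d}" for i r
    using separable_spectrum_majorized[OF cY(2) X sep, of G t F x] G F t0 x(2) \<kappa>(1)
    by (simp_all add: D_def d_def)
  have x1: "(\<Sum>i<d. x i) = 1"
  proof -
    have "mat_trace (reduced_op ?Y X \<rho>) = mat_trace \<rho>"
      using sum_diag_reduced_op[OF cY(2) X, of \<rho> "\<lambda>_. 1"] red st(1) \<kappa>(1)
      by (simp add: mat_trace_def d_def D_def)
    then show ?thesis using trace_diagonalized[OF F] st(3) by (metis of_real_eq_1_iff)
  qed
  have n0: "n 0 = 0" using shifted_hamiltonian_ground_eigenvalue[of ?Y \<alpha> E n] \<alpha> n by simp
  have m0: "m 0 = 0" using shifted_hamiltonian_ground_eigenvalue[of X \<alpha> E m] \<alpha>X m fX \<kappa>(1) by simp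
  have m1: "0 \<le> m 1" using monotone_onD[OF m(2), of 0 1] d m0 by (simp add: d_def)
  have "ground_energy E ?Y = ground_energy E X + ground_energy E (?Y - X)"
    unfolding ground_energy_def using sum.subset_diff[OF X cY(2), of E] by simp
  moreover have "ergotropy (hamiltonian E \<alpha> ?Y) \<rho> =
      energy (hamiltonian E \<alpha> ?Y) \<rho> - (\<Sum>i<D. n i * t i) - ground_energy E ?Y"
    using ergotropy_hamiltonian[OF cY(2), of E \<alpha> n \<rho> G t] n t(2) G t0 t1 by (simp add: D_def)
  moreover have "ergotropy (hamiltonian E \<alpha> X) (reduced_op ?Y X \<rho>) =
      energy (hamiltonian E \<alpha> X) (reduced_op ?Y X \<rho>) - (\<Sum>i<d. m i * x i) - ground_energy E X"
    using ergotropy_hamiltonian[OF fX, of E \<alpha> m "reduced_op ?Y X \<rho>" F x] m x(2) F maj(1) x1 \<kappa>(1)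
    by (simp add: d_def)
  \<comment> \<open>The energy of \<rho> cancels against those of the two marginals, and the ground
    energies cancel likewise.\<close>
  ultimately have gap: "ergotropic_gap E \<alpha> ?Y X \<rho> = (\<Sum>i<d. m i * x i) - (\<Sum>i<D. n i * t i)"
    using energy_hamiltonian_split[OF cY(2) X, of \<rho> E \<alpha>] st(1) by (simp add: ergotropic_gap_def D_def)
  have split0: "(\<Sum>i<k. f i) = f 0 + (\<Sum>i = 1..k - 1. f i)" if "0 < k" for f :: "nat \<Rightarrow> real" and k
  proof -
    have "{..<k} = insert 0 {1..k - 1}" using that by auto
    then show ?thesis by simp
  qed
  have "(\<Sum>i<d. m i * x i) - (\<Sum>i<D. n i * t i) \<le>
      (\<Sum>i = 1..d - 1. (m i - m 1) * x i) + (\<Sum>i = 1..D - 1. (m 1 - n i) * t i)"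
  proof -
    \<comment> \<open>Majorization with \<open>r = 1\<close>. As both spectra sum to 1, the tails
      compare the other way, and the claimed bound exceeds the gap by \<open>m 1\<close> times the
      difference of the tails.\<close>
    have "t 0 \<le> x 0" using maj(2)[of 1] d by (simp add: min_def)
    then have "(\<Sum>i = 1..d - 1. x i) \<le> (\<Sum>i = 1..D - 1. t i)"
      using split0[of d x] split0[of D t] d x1 t1 by simp
    then have "m 1 * (\<Sum>i = 1..d - 1. x i) \<le> m 1 * (\<Sum>i = 1..D - 1. t i)" using m1 by (rule mult_left_mono)
    then show ?thesis
      using split0[of d "\<lambda>i. m i * x i"] split0[of D "\<lambda>i. n i * t i"] d m0 n0
      by (simp add: left_diff_distrib sum_subtractf flip: sum_distrib_left)
  qed
  moreover have "(\<Sum>i<d. m i * x i) - (\<Sum>i<D. n i * t i) \<le>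
      (\<Sum>i = 1..d - 2. (m i - n i) * t i) + (\<Sum>i = d - 1..D - 1. (m (d - 1) - n i) * t i)"
  proof -
    \<comment> \<open>Continued by its last value, \<open>m\<close> stays increasing;
      \<open>x\<close> padded by zeros has exactly the partial sums that bound those of
      \<open>t\<close>.\<close>
    define m' where "m' i = m (min i (d - 1))" for i
    define x' where "x' i = (if i < d then x i else 0)" for i
    have x': "sum x' {..<k} = sum x {..<min k d}" for k
    proof -
      have "{..<k} \<inter> {i. i < d} = {..<min k d}" by auto
      then show ?thesis by (simp add: x'_def sum.If_cases)
    qed
    have "(\<Sum>i<D. m' i * x' i) \<le> (\<Sum>i<D. m' i * t i)"
    proof (rule sum_mono_weights_le)
      show "mono_on {..<D} m'" unfolding m'_def using d
        by (intro monotone_onI monotone_onD[OF m(2)]) (auto simp: d_def min_def)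
      show "sum t {..<k} \<le> sum x' {..<k}" if "k < D" for k using maj(2)[of k] that by (simp add: x')
      show "sum x' {..<D} = sum t {..<D}" using d x1 t1 by (simp add: x' min_def)
    qed
    moreover have "(\<Sum>i<D. m' i * x' i) = (\<Sum>i<d. m i * x i)"
      using d by (intro sum.mono_neutral_cong_right) (auto simp: m'_def x'_def min_def intro: arg_cong[of _ _ m])
    \<comment> \<open>Index 0 contributes nothing, as \<open>m' 0\<close> and \<open>n 0\<close> are
      0. The cut is at \<open>d - 1\<close> because \<open>m'\<close> is constant from there on; for
      \<open>d = 2\<close> the middle sum is empty.\<close>
    moreover have tail: "(\<Sum>i<D. f i) = f 0 + (\<Sum>i = 1..d - 2. f i) + (\<Sum>i = d - 1..D - 1. f i)" for f :: "nat \<Rightarrow> real"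
    proof -
      have "{1..D - 1} = {1..d - 2} \<union> {d - 1..D - 1}" "{1..d - 2} \<inter> {d - 1..D - 1} = {}" using d by auto
      then show ?thesis using split0[of D f] d by (simp add: sum.union_disjoint)
    qed
    have "(\<Sum>i<D. m' i * t i) - (\<Sum>i<D. n i * t i) = (\<Sum>i<D. (m' i - n i) * t i)"
      by (simp add: left_diff_distrib sum_subtractf)
    moreover have "\<dots> = (\<Sum>i = 1..d - 2. (m i - n i) * t i) + (\<Sum>i = d - 1..D - 1. (m (d - 1) - n i) * t i)"
      unfolding tail using m0 n0 by (simp add: m'_def min_def) (intro arg_cong2[of _ _ _ _ "(+)"] sum.cong, auto)
    ultimately show ?thesis by simp
  qed
  ultimately show ?thesis unfolding gap by (simp only: D_def d_def)
qed

end
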